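(* Let $(X,f)$ be a dynamical system ($X$ compact metric, $f$ continuous) satisfying: (H1) the entropy map $\mu\mapsto h_\mu(f)$ is upper semicontinuous on $\mathcal M_f(X)$; (H2) every Lipschitz potential on $X$ has a unique equilibrium state; (H3) $(X,f)$ has the saturated property for every invariant measure. For $\varphi\in C(X)$ let $E(\varphi):R(\varphi;X,f)\to\mathbb R$, $E(\varphi)(\alpha)=h_{\mathrm{top}}(f,L(\varphi,\alpha;X,f))$, and let $\Gamma_{E(\varphi)}=\{(\alpha,E(\varphi)(\alpha)):\alpha\in R(\varphi;X,f)\}\subset\mathbb R^2$. Then the map $\varphi\mapsto\Gamma_{E(\varphi)}$ is lower semicontinuous at every $\varphi\in C(X)$ (with $C(X)$ carrying the sup norm), i.e. for every sequence $\varphi_n\to\varphi$ uniformly, $$\sup_{q\in\Gamma_{E(\varphi)}}\operatorname{dist}(q,\Gamma_{E(\varphi_n)})\to0.$$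
   Context: $\mathcal M_f(X)$: $f$-invariant Borel probability measures, weak$^*$ topology; $h_\mu(f)$ metric entropy; $h_{\mathrm{top}}(f,Y)$ Bowen's topological entropy of a set $Y$. An equilibrium state for $\varphi$ is $\nu$ attaining $\sup_\mu(h_\mu(f)+\int\varphi\,d\mu)$. $G_\mu=\{x:\frac1n\sum_{k<n}\delta_{f^kx}\to\mu\}$; the saturated property for every invariant measure means $G_\mu\ne\emptyset$ and $h_{\mathrm{top}}(f,G_\mu)=h_\mu(f)$ for all $\mu\in\mathcal M_f(X)$. $L(\varphi,\alpha;X,f)=\{x:\lim_n\frac1n\sum_{k<n}\varphi(f^kx)=\alpha\}$, $R(\varphi;X,f)=\{\alpha:L(\varphi,\alpha;X,f)\ne\emptyset\}$. $\operatorname{dist}(q,B)=\inf_{b\in B}|q-b|$ in $\mathbb R^2$. *)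

theory Defs
  imports "HOL-Probability.Probability"
begin

text \<open>The phase space X is the whole (compact) type 'a; f : 'a => 'a is continuous.\<close>

definition invariant_measures :: "('a::metric_space \<Rightarrow> 'a) \<Rightarrow> 'a measure set" where
  "invariant_measures f = {\<mu>. sets \<mu> = sets borel \<and> prob_space \<mu> \<and>
      (\<forall>A\<in>sets borel. emeasure \<mu> (f -` A) = emeasure \<mu> A)}"

definition weak_conv :: "(nat \<Rightarrow> 'a::metric_space measure) \<Rightarrow> 'a measure \<Rightarrow> bool" where
  "weak_conv \<mu>s \<mu> \<longleftrightarrow> (\<forall>g::'a \<Rightarrow> real. continuous_on UNIV g \<longrightarrow>
      (\<lambda>n. integral\<^sup>L (\<mu>s n) g) \<longlonglongrightarrow> integral\<^sup>L \<mu> g)"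

definition borel_partitions :: "'a::metric_space set set set" where
  "borel_partitions = {P. finite P \<and> P \<subseteq> sets borel \<and> disjoint P \<and> \<Union>P = UNIV}"

definition partition_entropy :: "'a measure \<Rightarrow> 'a set set \<Rightarrow> real" where
  "partition_entropy \<mu> P = - (\<Sum>A\<in>P. (if measure \<mu> A = 0 then 0
                                         else measure \<mu> A * ln (measure \<mu> A)))"

definition iter_join :: "('a \<Rightarrow> 'a) \<Rightarrow> 'a set set \<Rightarrow> nat \<Rightarrow> 'a set set" where
  "iter_join f P n = {(\<Inter>i<n. (f ^^ i) -` (c i)) | c. \<forall>i<n. c i \<in> P}"

definition metric_entropy :: "('a::metric_space \<Rightarrow> 'a) \<Rightarrow> 'a measure \<Rightarrow> ereal" where
  "metric_entropy f \<mu> = (SUP P\<in>borel_partitions.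
      ereal (lim (\<lambda>n. partition_entropy \<mu> (iter_join f P n) / real n)))"

definition bowen_ball :: "('a::metric_space \<Rightarrow> 'a) \<Rightarrow> 'a \<Rightarrow> nat \<Rightarrow> real \<Rightarrow> 'a set" where
  "bowen_ball f x n \<epsilon> = {y. \<forall>i<n. dist ((f ^^ i) x) ((f ^^ i) y) < \<epsilon>}"

definition bowen_M :: "('a::metric_space \<Rightarrow> 'a) \<Rightarrow> 'a set \<Rightarrow> real \<Rightarrow> real \<Rightarrow> nat \<Rightarrow> ennreal" where
  "bowen_M f Y s \<epsilon> N = (INF C\<in>{C. countable C \<and> (\<forall>p\<in>C. snd p \<ge> N) \<and>
         Y \<subseteq> (\<Union>p\<in>C. bowen_ball f (fst p) (snd p) \<epsilon>)}.
       nn_integral (count_space C) (\<lambda>p. ennreal (exp (- s * real (snd p)))))"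

definition bowen_m :: "('a::metric_space \<Rightarrow> 'a) \<Rightarrow> 'a set \<Rightarrow> real \<Rightarrow> real \<Rightarrow> ennreal" where
  "bowen_m f Y s \<epsilon> = (SUP N. bowen_M f Y s \<epsilon> N)"

definition htop_eps :: "('a::metric_space \<Rightarrow> 'a) \<Rightarrow> 'a set \<Rightarrow> real \<Rightarrow> ereal" where
  "htop_eps f Y \<epsilon> = Inf (ereal ` {s. 0 \<le> s \<and> bowen_m f Y s \<epsilon> = 0})"

definition htop :: "('a::metric_space \<Rightarrow> 'a) \<Rightarrow> 'a set \<Rightarrow> ereal" where
  "htop f Y = (SUP \<epsilon>\<in>{0<..}. htop_eps f Y \<epsilon>)"

definition equilibrium_state :: "('a::metric_space \<Rightarrow> 'a) \<Rightarrow> ('a \<Rightarrow> real) \<Rightarrow> 'a measure \<Rightarrow> bool" where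
  "equilibrium_state f \<phi> \<nu> \<longleftrightarrow> \<nu> \<in> invariant_measures f \<and>
     metric_entropy f \<nu> + ereal (integral\<^sup>L \<nu> \<phi>) =
       (SUP \<mu>\<in>invariant_measures f. metric_entropy f \<mu> + ereal (integral\<^sup>L \<mu> \<phi>))"

definition generic_points :: "('a::metric_space \<Rightarrow> 'a) \<Rightarrow> 'a measure \<Rightarrow> 'a set" where
  "generic_points f \<mu> = {x. \<forall>g::'a \<Rightarrow> real. continuous_on UNIV g \<longrightarrow>
      (\<lambda>n. (\<Sum>k<n. g ((f ^^ k) x)) / real n) \<longlonglongrightarrow> integral\<^sup>L \<mu> g}"

definition saturated :: "('a::metric_space \<Rightarrow> 'a) \<Rightarrow> bool" where
  "saturated f \<longleftrightarrow> (\<forall>\<mu>\<in>invariant_measures f.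
      generic_points f \<mu> \<noteq> {} \<and> htop f (generic_points f \<mu>) = metric_entropy f \<mu>)"

definition level_set :: "('a \<Rightarrow> 'a) \<Rightarrow> ('a \<Rightarrow> real) \<Rightarrow> real \<Rightarrow> 'a set" where
  "level_set f \<phi> \<alpha> = {x. (\<lambda>n. (\<Sum>k<n. \<phi> ((f ^^ k) x)) / real n) \<longlonglongrightarrow> \<alpha>}"

definition spectrum_R :: "('a \<Rightarrow> 'a) \<Rightarrow> ('a \<Rightarrow> real) \<Rightarrow> real set" where
  "spectrum_R f \<phi> = {\<alpha>. level_set f \<phi> \<alpha> \<noteq> {}}"

definition entropy_graph :: "('a::metric_space \<Rightarrow> 'a) \<Rightarrow> ('a \<Rightarrow> real) \<Rightarrow> (real \<times> real) set" where
  "entropy_graph f \<phi> = {(\<alpha>, real_of_ereal (htop f (level_set f \<phi> \<alpha>))) | \<alpha>. \<alpha> \<in> spectrum_R f \<phi>}"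

end

theory Submission
  imports Defs
begin

text \<open>For every \<alpha> in the spectrum of \<phi>, the entropy of the level set is the supremum of the
  entropies of the invariant measures with integral \<alpha>. The saturated property gives one
  inequality. For the other, the points whose Birkhoff averages stay \<delta>-close to \<alpha> from some time
  on contain maximal separated sets; Misiurewicz' argument turns these into an invariant measure
  whose integral is \<delta>-close to \<alpha> and whose entropy is at least their growth rate, and upper
  semicontinuity removes the \<delta>.

  The spectrum is then concave in \<alpha>, hence lower semicontinuous up to the endpoints. A measure
  nearly optimal for (\<phi>, \<alpha>) gives a nearby value \<beta> for the perturbed potential at which the
  perturbed spectrum is almost as large; if it were much larger uniformly often, a weak limit of
  optimal measures would violate concavity and upper semicontinuity. The equilibrium
  state of the zero potential attains the supremum of the entropies; if that is infinite, mixing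
  and uniqueness leave only one invariant measure, and the graphs are single points.\<close>

section \<open>Entropy of finite labellings\<close>

text \<open>Partitions enter the proof as labellings: a function with finitely many values stands
  for the partition into its fibres, words of labels stand for iterated joins, and coarsening is
  post-composition. Inequalities of information theory then apply alike to invariant measures and to
  uniform distributions on finite sets. Two obstacles shape the rest. First,
  \<open>real_of_ereal\<close> sends infinity to 0, so heights of the graph can be compared only
  once the entropies are known to be finite; hence the separate treatment of infinite entropy.
  Second, the estimate must be uniform in \<alpha>, without a common modulus of continuity for the
  perturbed spectra. Its negation supplies a sequence of bad pairs (n, \<alpha>), and weak
  compactness of the invariant measures takes the place of such a modulus.\<close>

definition eta :: "real \<Rightarrow> real" where
  "eta x = - (x * ln x)"

definition label_entropy :: "'a measure \<Rightarrow> ('a \<Rightarrow> 'l) \<Rightarrow> real" where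
  "label_entropy M c = (\<Sum>l\<in>c ` space M. eta (measure M (c -` {l} \<inter> space M)))"

lemma eta_0 [simp]: "eta 0 = 0"
  by (simp add: eta_def)

lemma eta_nonneg: "0 \<le> x \<Longrightarrow> x \<le> 1 \<Longrightarrow> 0 \<le> eta x"
  by (cases "x = 0") (auto simp: eta_def mult_le_0_iff)

text \<open>The right side is the tangent to \<open>eta\<close> at \<open>m\<close>; the inequality
  is \<open>ln y \<le> y - 1\<close> at \<open>y = m / x\<close>, multiplied by
  \<open>x\<close>.\<close>

lemma eta_le_tangent:
  assumes "0 \<le> x" "0 < m"
  shows "eta x \<le> - (x * ln m) - x + m"
proof (cases "x = 0")
  case False
  then have x: "x > 0" using assms by simp
  have "ln (m / x) \<le> m / x - 1" using x assms by (intro ln_le_minus_one) simp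
  then have "x * (ln m - ln x) \<le> x * (m / x - 1)"
    using x assms by (intro mult_left_mono) (auto simp: ln_div)
  then show ?thesis using x by (simp add: eta_def algebra_simps)
qed (use assms in simp)

text \<open>Jensen's inequality by averaging tangents at the barycentre. A barycentre 0 is treated
  apart, because \<open>eta\<close> has a vertical tangent there; all terms then vanish.\<close>

lemma eta_concave:
  assumes fin: "finite I" and p: "\<And>i. i \<in> I \<Longrightarrow> 0 \<le> p i" and p1: "(\<Sum>i\<in>I. p i) = 1"
    and x: "\<And>i. i \<in> I \<Longrightarrow> 0 \<le> x i"
  shows "(\<Sum>i\<in>I. p i * eta (x i)) \<le> eta (\<Sum>i\<in>I. p i * x i)"
proof -
  define m where "m = (\<Sum>i\<in>I. p i * x i)"
  have m0: "0 \<le> m" unfolding m_def using p x by (intro sum_nonneg) auto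
  show ?thesis
  proof (cases "m = 0")
    case True
    then have "\<forall>i\<in>I. p i * x i = 0"
      unfolding m_def using fin p x by (subst (asm) sum_nonneg_eq_0_iff) auto
    then have "(\<Sum>i\<in>I. p i * eta (x i)) = 0"
      by (intro sum.neutral) (auto simp: eta_def)
    then show ?thesis using True by (simp add: m_def)
  next
    case False
    with m0 have "m > 0" by simp
    have "(\<Sum>i\<in>I. p i * eta (x i)) \<le> (\<Sum>i\<in>I. p i * (- (x i * ln m) - x i + m))"
      using p x \<open>m > 0\<close> by (intro sum_mono mult_left_mono eta_le_tangent) auto
    also have "\<dots> = (\<Sum>i\<in>I. (p i * x i) * (- ln m - 1) + p i * m)"
      by (intro sum.cong) (auto simp: algebra_simps)
    also have "\<dots> = m * (- ln m - 1) + m"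
      by (simp add: sum.distrib p1 m_def flip: sum_distrib_right)
    also have "\<dots> = eta m" by (simp add: eta_def algebra_simps)
    finally show ?thesis by (simp add: m_def)
  qed
qed

context prob_space begin

lemma information_space_e: "information_space M (exp 1)"
  by (rule information_space.intro[OF prob_space_axioms], unfold_locales) simp

text \<open>Bridge to information theory: in base \<open>exp 1\<close> the logarithm is
  \<open>ln\<close>, so data processing, the chain rule and the cardinality bound carry over to
  labellings.\<close>

lemma label_entropy_eq:
  assumes "simple_function M c"
  shows "label_entropy M c = entropy (exp 1) (count_space (c ` space M)) c"
proof -
  interpret information_space M "exp 1" by (rule information_space_e)
  show ?thesis
    by (subst entropy_simple_distributed[OF simple_distributedI[OF assms measure_nonneg refl]])
      (simp add: label_entropy_def eta_def log_def sum_negf)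
qed

lemma label_entropy_nonneg: "0 \<le> label_entropy M c"
  unfolding label_entropy_def by (intro sum_nonneg eta_nonneg) auto

lemma label_entropy_compose_le:
  assumes "simple_function M c"
  shows "label_entropy M (\<lambda>x. g (c x)) \<le> label_entropy M c"
proof -
  interpret information_space M "exp 1" by (rule information_space_e)
  have "simple_function M (g \<circ> c)" using assms by auto
  then show ?thesis
    using entropy_data_processing[OF assms, of g] label_entropy_eq[OF assms] label_entropy_eq[of "g \<circ> c"]
    by (simp add: comp_def)
qed

lemma label_entropy_Pair_le:
  assumes "simple_function M c" "simple_function M d"
  shows "label_entropy M (\<lambda>x. (c x, d x)) \<le> label_entropy M c + label_entropy M d"
proof -
  interpret information_space M "exp 1" by (rule information_space_e)
  show ?thesis
    using entropy_chain_rule[OF assms] conditional_entropy_less_eq_entropy[OF assms(2,1)]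
    by (simp add: label_entropy_eq assms simple_function_Pair)
qed

lemma label_entropy_le_card:
  assumes c: "simple_function M c" and S: "c ` space M \<subseteq> S" "finite S"
  shows "label_entropy M c \<le> ln (card S)"
proof -
  interpret information_space M "exp 1" by (rule information_space_e)
  have "label_entropy M c \<le> ln (card (c ` space M))"
    using entropy_le_card[OF simple_distributedI[OF c measure_nonneg refl]]
    by (simp add: label_entropy_eq c log_def)
  also have "\<dots> \<le> ln (card S)"
  proof (subst ln_le_cancel_iff)
    show "real (card (c ` space M)) \<le> real (card S)" using S by (simp add: card_mono)
    moreover show "0 < real (card (c ` space M))"
      using S not_empty finite_subset[OF S] by (simp add: card_gt_0_iff)
    ultimately show "0 < real (card S)" by linarith
  qed
  finally show ?thesis .
qed

end

text \<open>Values that are not attained have empty fibres and contribute \<open>eta 0 = 0\<close>.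
  Labellings of different spaces can thus be compared over one common set \<open>S\<close>.\<close>

lemma label_entropy_superset:
  assumes "finite S" "c ` space M \<subseteq> S"
  shows "label_entropy M c = (\<Sum>l\<in>S. eta (measure M (c -` {l} \<inter> space M)))"
  unfolding label_entropy_def
proof (rule sum.mono_neutral_left[OF assms], safe)
  fix l assume "l \<notin> c ` space M"
  then have "c -` {l} \<inter> space M = {}" by auto
  then show "eta (measure M (c -` {l} \<inter> space M)) = 0" by (metis eta_0 measure_empty)
qed

text \<open>Jensen for each label. Every component has its own space and labelling, so that one
  uniform distribution read at different times can supply all components, with an orbit average as
  the mixture.\<close>

lemma label_entropy_concave:
  assumes fin: "finite I" and p: "\<And>i. i \<in> I \<Longrightarrow> 0 \<le> p i" and p1: "(\<Sum>i\<in>I. p i) = 1"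
    and S: "finite S" "c ` space M \<subseteq> S" "\<And>i. i \<in> I \<Longrightarrow> d i ` space (N i) \<subseteq> S"
    and M: "\<And>l. l \<in> S \<Longrightarrow> measure M (c -` {l} \<inter> space M) = (\<Sum>i\<in>I. p i * measure (N i) (d i -` {l} \<inter> space (N i)))"
  shows "(\<Sum>i\<in>I. p i * label_entropy (N i) (d i)) \<le> label_entropy M c"
proof -
  have "(\<Sum>i\<in>I. p i * label_entropy (N i) (d i)) =
      (\<Sum>i\<in>I. p i * (\<Sum>l\<in>S. eta (measure (N i) (d i -` {l} \<inter> space (N i)))))"
    using S by (intro sum.cong refl) (auto simp: label_entropy_superset)
  also have "\<dots> = (\<Sum>l\<in>S. \<Sum>i\<in>I. p i * eta (measure (N i) (d i -` {l} \<inter> space (N i))))"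
    by (subst sum.swap) (simp add: sum_distrib_left)
  also have "\<dots> \<le> (\<Sum>l\<in>S. eta (\<Sum>i\<in>I. p i * measure (N i) (d i -` {l} \<inter> space (N i))))"
    by (intro sum_mono eta_concave fin p p1) auto
  also have "\<dots> = label_entropy M c"
    using S M by (simp add: label_entropy_superset)
  finally show ?thesis .
qed

text \<open>The itinerary of length \<open>n\<close>. Its nonempty fibres are the nonempty cells of
  the \<open>n\<close>-fold join, and the words of consecutive stretches concatenate.\<close>

definition word :: "('a \<Rightarrow> 'a) \<Rightarrow> ('a \<Rightarrow> 'l) \<Rightarrow> nat \<Rightarrow> 'a \<Rightarrow> 'l list" where
  "word f c n x = map (\<lambda>i. c ((f ^^ i) x)) [0..<n]"

lemma word_eq_iff: "word f c n x = word f c n y \<longleftrightarrow> (\<forall>i<n. c ((f ^^ i) x) = c ((f ^^ i) y))"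
  by (auto simp: word_def)

lemma word_add: "word f c (a + b) x = word f c a x @ word f c b ((f ^^ a) x)"
proof (induction b)
  case (Suc b)
  then show ?case by (simp add: word_def flip: funpow_add) (metis add.commute comp_apply funpow_add)
qed (simp add: word_def)

lemma word_0 [simp]: "word f c 0 = (\<lambda>x. [])"
  by (simp add: word_def fun_eq_iff)

lemma word_Suc: "word f c (Suc n) x = word f c n x @ [c ((f ^^ n) x)]"
  by (simp add: word_def)

text \<open>Labels may be read along a map g out of an auxiliary space, so that the
  estimate applies to uniform distributions on finite sets.\<close>

lemma simple_function_word:
  assumes "\<And>i. i < n \<Longrightarrow> simple_function M (\<lambda>x. c ((f ^^ i) (g x)))"
  shows "simple_function M (\<lambda>x. word f c n (g x))"
  using assms
proof (induction n)
  case (Suc n)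
  have "simple_function M (\<lambda>x. (word f c n (g x), c ((f ^^ n) (g x))))"
    using Suc by (intro simple_function_Pair) auto
  then have "simple_function M ((\<lambda>(w, l). w @ [l]) \<circ> (\<lambda>x. (word f c n (g x), c ((f ^^ n) (g x)))))"
    by (rule simple_function_compose)
  then show ?case by (simp add: comp_def word_Suc)
qed simp

lemma (in prob_space) label_entropy_word_add_le:
  assumes c: "\<And>i. simple_function M (\<lambda>x. c ((f ^^ i) (g x)))"
  shows "label_entropy M (\<lambda>x. word f c (a + b) (g x))
    \<le> label_entropy M (\<lambda>x. word f c a (g x)) + label_entropy M (\<lambda>x. word f c b ((f ^^ a) (g x)))"
proof -
  have 1: "simple_function M (\<lambda>x. word f c a (g x))" by (intro simple_function_word c)
  have 2: "simple_function M (\<lambda>x. word f c b ((f ^^ a) (g x)))"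
    using c[of "_ + a"] by (intro simple_function_word) (simp add: funpow_add)
  have "label_entropy M (\<lambda>x. word f c (a + b) (g x)) =
     label_entropy M (\<lambda>x. (\<lambda>(u, v). u @ v) (word f c a (g x), word f c b ((f ^^ a) (g x))))"
    by (simp add: word_add)
  also have "\<dots> \<le> label_entropy M (\<lambda>x. (word f c a (g x), word f c b ((f ^^ a) (g x))))"
    by (intro label_entropy_compose_le simple_function_Pair 1 2)
  also have "\<dots> \<le> label_entropy M (\<lambda>x. word f c a (g x)) + label_entropy M (\<lambda>x. word f c b ((f ^^ a) (g x)))"
    by (intro label_entropy_Pair_le 1 2)
  finally show ?thesis .
qed

section \<open>Metric entropy\<close>

text \<open>A choice of cells may have empty intersection, and \<open>P\<close> may contain the
  empty set; deleting it makes the correspondence exact. If an intersection contains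
  \<open>x\<close>, its i-th cell must be the fibre through the i-th iterate of
  \<open>x\<close>.\<close>

lemma iter_join_fibres:
  assumes P: "P - {{}} = range (\<lambda>x. c -` {c x})"
  shows "iter_join f P n - {{}} = range (\<lambda>x. word f c n -` {word f c n x})"
proof (intro equalityI subsetI)
  fix A assume "A \<in> iter_join f P n - {{}}"
  then obtain C x where A: "A = (\<Inter>i<n. (f ^^ i) -` C i)" and C: "\<And>i. i < n \<Longrightarrow> C i \<in> P" and x: "x \<in> A"
    unfolding iter_join_def by auto
  have "C i = c -` {c ((f ^^ i) x)}" if "i < n" for i
  proof -
    have m: "(f ^^ i) x \<in> C i" using x that by (auto simp: A)
    with C[OF that] P have "C i \<in> range (\<lambda>x. c -` {c x})" by blast
    with m show ?thesis by auto
  qed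
  then have "A = word f c n -` {word f c n x}"
    by (auto simp: A word_eq_iff)
  then show "A \<in> range (\<lambda>x. word f c n -` {word f c n x})" by blast
next
  fix A assume "A \<in> range (\<lambda>x. word f c n -` {word f c n x})"
  then obtain x where A: "A = word f c n -` {word f c n x}" by blast
  have "A = (\<Inter>i<n. (f ^^ i) -` (c -` {c ((f ^^ i) x)}))"
    by (auto simp: A word_eq_iff)
  moreover have "c -` {c y} \<in> P" for y using P by blast
  ultimately have "A \<in> iter_join f P n"
    unfolding iter_join_def by (intro CollectI exI[of _ "\<lambda>i. c -` {c ((f ^^ i) x)}"]) simp
  then show "A \<in> iter_join f P n - {{}}" using A by blast
qed

lemma partition_entropy_eq_label_entropy:
  assumes "space \<mu> = UNIV" "finite (range c)" "P - {{}} = range (\<lambda>x. c -` {c x})"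
  shows "partition_entropy \<mu> P = label_entropy \<mu> c"
proof -
  have ran: "range (\<lambda>x. c -` {c x}) = (\<lambda>l. c -` {l}) ` range c" by auto
  have "finite P"
    using assms(2,3) ran by (metis finite.emptyI finite.insertI finite_Diff2 finite_imageI)
  have "partition_entropy \<mu> P = (\<Sum>A\<in>P. eta (measure \<mu> A))"
    unfolding partition_entropy_def sum_negf[symmetric] by (intro sum.cong) (auto simp: eta_def)
  also have "\<dots> = (\<Sum>A\<in>P - {{}}. eta (measure \<mu> A))"
    using \<open>finite P\<close> by (intro sum.mono_neutral_right) auto
  also have "\<dots> = (\<Sum>A\<in>(\<lambda>l. c -` {l}) ` range c. eta (measure \<mu> A))"
    by (simp only: assms(3) ran)
  also have "\<dots> = label_entropy \<mu> c"
    unfolding label_entropy_def using assms(1)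
    by (subst sum.reindex) (auto simp: inj_on_def)
  finally show ?thesis .
qed

lemma finite_range_word: "finite (range c) \<Longrightarrow> finite (range (word f c n))"
  by (rule finite_subset[OF _ finite_lists_length_eq[of "range c" n]]) (auto simp: word_def)

lemma partition_entropy_iter_join:
  assumes "space \<mu> = UNIV" "finite (range c)" "P - {{}} = range (\<lambda>x. c -` {c x})"
  shows "partition_entropy \<mu> (iter_join f P n) = label_entropy \<mu> (word f c n)"
  by (intro partition_entropy_eq_label_entropy finite_range_word iter_join_fibres assms)

section \<open>Entropy rates as infima\<close>

lemma fekete:
  fixes a :: "nat \<Rightarrow> real"
  assumes sub: "\<And>m n. a (m + n) \<le> a m + a n" and nn: "\<And>n. 0 \<le> a n"
  shows "(\<lambda>n. a n / real n) \<longlonglongrightarrow> (INF m\<in>{1..}. a m / real m)"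
proof -
  define L where "L = (INF m\<in>{1..}. a m / real m)"
  have bdd: "bdd_below ((\<lambda>m. a m / real m) ` {1..})"
    by (rule bdd_belowI2[of _ 0]) (simp add: nn)
  have lower: "L \<le> a n / real n" if "n \<ge> 1" for n
    unfolding L_def using bdd that by (intro cINF_lower) auto
  have mult: "a (q * m + r) \<le> real q * a m + a r" for q m r
  proof (induction q)
    case (Suc q)
    have "a (Suc q * m + r) \<le> a m + a (q * m + r)" using sub[of m "q * m + r"] by (simp add: algebra_simps)
    with Suc show ?case by (simp add: algebra_simps)
  qed simp
  show ?thesis
    unfolding L_def[symmetric]
  proof (rule LIMSEQ_I)
    fix e :: real assume "e > 0"
    obtain m where m: "m \<ge> 1" "a m / real m < L + e / 2"
    proof -
      have "L < L + e / 2" using \<open>e > 0\<close> by simp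
      then have "\<exists>m\<in>{1..}. a m / real m < L + e / 2"
        unfolding L_def by (subst (asm) cINF_less_iff[OF _ bdd]) auto
      then show ?thesis using that by auto
    qed
    \<comment> \<open>\<open>B\<close> dominates every remainder term \<open>a (n mod m)\<close> at
      once; after division by \<open>n\<close> it disappears.\<close>
    define B where "B = (\<Sum>r<m. a r)"
    have B: "a r \<le> B" if "r < m" for r
      unfolding B_def using that nn by (intro member_le_sum) auto
    have "B \<ge> 0" unfolding B_def by (intro sum_nonneg nn)
    obtain N where N: "real N > 2 * B / e" using reals_Archimedean2 by blast
    show "\<exists>no. \<forall>n\<ge>no. norm (a n / real n - L) < e"
    proof (intro exI allI impI)
      fix n assume n: "n \<ge> max N 1"
      have "a n \<le> real (n div m) * a m + a (n mod m)"
        using mult[of "n div m" m "n mod m"] by simp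
      also have "\<dots> \<le> real (n div m) * a m + B"
        using B[of "n mod m"] m by simp
      also have "real (n div m) * a m = (real (n div m) * real m) * (a m / real m)"
        using m by simp
      also have "\<dots> \<le> real n * (a m / real m)"
      proof (intro mult_right_mono)
        show "real (n div m) * real m \<le> real n"
          by (metis div_times_less_eq_dividend of_nat_le_iff of_nat_mult)
      qed (simp add: nn)
      finally have "a n / real n \<le> a m / real m + B / real n"
        using n by (simp add: field_simps)
      moreover have "B / real n < e / 2"
      proof -
        have "real n > 2 * B / e" using N n by linarith
        then show ?thesis using n \<open>e > 0\<close> by (simp add: field_simps)
      qed
      ultimately have "a n / real n < L + e" using m(2) by linarith
      then show "norm (a n / real n - L) < e"
        using lower[of n] n by simp
    qed
  qed
qed

lemma invariant_measuresD:
  assumes "\<mu> \<in> invariant_measures f"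
  shows "sets \<mu> = sets borel" "space \<mu> = UNIV" "prob_space \<mu>"
    "\<And>A. A \<in> sets borel \<Longrightarrow> measure \<mu> (f -` A) = measure \<mu> A"
  using assms sets_eq_imp_space_eq[of \<mu> borel] by (auto simp: invariant_measures_def measure_def)

lemma continuous_on_funpow:
  assumes "continuous_on UNIV (f :: 'a::topological_space \<Rightarrow> 'a)"
  shows "continuous_on UNIV (f ^^ n)"
proof (induction n)
  case (Suc n)
  have "continuous_on UNIV (f \<circ> (f ^^ n))"
    using Suc assms by (intro continuous_on_compose) (auto intro: continuous_on_subset)
  then show ?case by (simp add: comp_def)
qed (simp add: id_def)

lemma measurable_funpow:
  assumes "continuous_on UNIV (f :: 'a::topological_space \<Rightarrow> 'a)"
  shows "f ^^ n \<in> borel_measurable borel"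
  by (intro borel_measurable_continuous_onI continuous_on_funpow assms)

lemma vimage_funpow_borel:
  assumes "continuous_on UNIV (f :: 'a::topological_space \<Rightarrow> 'a)" "A \<in> sets borel"
  shows "(f ^^ n) -` A \<in> sets borel"
  using measurable_sets[OF measurable_funpow[OF assms(1)] assms(2)] by simp

lemma measure_vimage_funpow:
  assumes f: "continuous_on UNIV f" and \<mu>: "\<mu> \<in> invariant_measures f" and A: "A \<in> sets borel"
  shows "measure \<mu> ((f ^^ n) -` A) = measure \<mu> A"
proof (induction n)
  case (Suc n)
  have "(f ^^ Suc n) -` A = f -` ((f ^^ n) -` A)" by (auto simp: funpow_swap1)
  then show ?case
    using Suc invariant_measuresD(4)[OF \<mu> vimage_funpow_borel[OF f A]] by metis
qed simp

lemma simple_function_borel_cong: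
  "sets \<mu> = sets borel \<Longrightarrow> simple_function \<mu> c \<longleftrightarrow> simple_function borel c"
  using sets_eq_imp_space_eq[of \<mu> borel] by (simp add: simple_function_def)

lemma simple_function_funpow:
  fixes f :: "'a::topological_space \<Rightarrow> 'a"
  assumes "continuous_on UNIV f" "simple_function borel c"
  shows "simple_function borel (\<lambda>x. c ((f ^^ i) x))"
proof -
  have "(\<lambda>x. c ((f ^^ i) x)) -` {l} \<in> sets borel" for l
  proof -
    have "c -` {l} \<in> sets borel"
      using assms(2) simple_functionD(2)[OF assms(2), of "{l}"] by simp
    from vimage_funpow_borel[OF assms(1) this] show ?thesis by (simp add: vimage_def)
  qed
  moreover have "finite (range (\<lambda>x. c ((f ^^ i) x)))"
    by (rule finite_subset[of _ "range c"]) (use simple_functionD(1)[OF assms(2)] in auto)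
  ultimately show ?thesis by (simp add: simple_function_def)
qed

lemma simple_function_word_borel:
  assumes "continuous_on UNIV f" "simple_function borel c"
  shows "simple_function borel (word f c n)"
  using simple_function_word[of n borel c f "\<lambda>x. x"] simple_function_funpow[OF assms] by simp

lemma label_entropy_word_shift:
  assumes f: "continuous_on UNIV f" and \<mu>: "\<mu> \<in> invariant_measures f" and c: "simple_function borel c"
  shows "label_entropy \<mu> (\<lambda>x. word f c b ((f ^^ a) x)) = label_entropy \<mu> (word f c b)"
proof -
  have fin: "finite (range (word f c b))"
    using c by (intro finite_range_word) (auto simp: simple_function_def)
  have "label_entropy \<mu> (\<lambda>x. word f c b ((f ^^ a) x)) =
     (\<Sum>l\<in>range (word f c b). eta (measure \<mu> ((f ^^ a) -` (word f c b -` {l}))))"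
    using invariant_measuresD(2)[OF \<mu>]
    by (subst label_entropy_superset[OF fin]) (auto simp: vimage_def)
  also have "\<dots> = (\<Sum>l\<in>range (word f c b). eta (measure \<mu> (word f c b -` {l})))"
    using simple_functionD(2)[OF simple_function_word_borel[OF f c]]
    by (intro sum.cong refl) (subst measure_vimage_funpow[OF f \<mu>], auto)
  also have "\<dots> = label_entropy \<mu> (word f c b)"
    using invariant_measuresD(2)[OF \<mu>] by (simp add: label_entropy_def)
  finally show ?thesis .
qed

lemma label_entropy_word_limit:
  assumes f: "continuous_on UNIV f" and \<mu>: "\<mu> \<in> invariant_measures f" and c: "simple_function borel c"
  shows "(\<lambda>n. label_entropy \<mu> (word f c n) / real n)
    \<longlonglongrightarrow> (INF m\<in>{1..}. label_entropy \<mu> (word f c m) / real m)"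
proof (rule fekete)
  note \<mu>' = invariant_measuresD[OF \<mu>]
  interpret prob_space \<mu> by (rule \<mu>')
  show "0 \<le> label_entropy \<mu> (word f c n)" for n by (rule label_entropy_nonneg)
  fix m n
  have "simple_function \<mu> (\<lambda>x. c ((f ^^ i) x))" for i
    using simple_function_funpow[OF f c] by (simp add: simple_function_borel_cong[OF \<mu>'(1)])
  from label_entropy_word_add_le[of c f "\<lambda>x. x", OF this, of m n]
  show "label_entropy \<mu> (word f c (m + n)) \<le> label_entropy \<mu> (word f c m) + label_entropy \<mu> (word f c n)"
    by (simp add: label_entropy_word_shift[OF f \<mu> c])
qed

text \<open>By subadditivity the limit in the definition of entropy is an infimum over
  \<open>m \<ge> 1\<close>; a linear lower bound for all word lengths therefore suffices, and no
  limit has to be evaluated.\<close>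

lemma metric_entropy_geI:
  assumes f: "continuous_on UNIV f" and \<mu>: "\<mu> \<in> invariant_measures f" and c: "simple_function borel c"
    and t: "\<And>m. m \<ge> 1 \<Longrightarrow> t * real m \<le> label_entropy \<mu> (word f c m)"
  shows "ereal t \<le> metric_entropy f \<mu>"
proof -
  define P where "P = range (\<lambda>x. c -` {c x})"
  have fin: "finite (range c)" using c by (simp add: simple_function_def)
  have "c -` {c x} \<in> sets borel" for x
    using simple_functionD(2)[OF c, of "{c x}"] by simp
  moreover have "finite P"
  proof -
    have "P = (\<lambda>l. c -` {l}) ` range c" by (auto simp: P_def)
    with fin show ?thesis by simp
  qed
  ultimately have P: "P \<in> borel_partitions"
    by (auto simp: borel_partitions_def P_def disjoint_def)
  have "P - {{}} = range (\<lambda>x. c -` {c x})" by (auto simp: P_def)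
  from partition_entropy_iter_join[OF invariant_measuresD(2)[OF \<mu>] fin this]
  have *: "partition_entropy \<mu> (iter_join f P n) = label_entropy \<mu> (word f c n)" for n .
  have "t \<le> lim (\<lambda>n. partition_entropy \<mu> (iter_join f P n) / real n)"
    unfolding * limI[OF label_entropy_word_limit[OF f \<mu> c]]
    using t by (intro cINF_greatest) (auto simp: field_simps)
  then have "ereal t \<le> ereal (lim (\<lambda>n. partition_entropy \<mu> (iter_join f P n) / real n))" by simp
  also have "\<dots> \<le> metric_entropy f \<mu>"
    unfolding metric_entropy_def using P by (intro SUP_upper)
  finally show ?thesis .
qed

text \<open>Each point is labelled by the partition cell containing it, hence labels of type
  \<open>'a set\<close>. Since the entropy rate is an infimum, a rate above \<open>t\<close> gives
  the linear bound at every \<open>m\<close>, not only asymptotically.\<close>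

lemma metric_entropy_greaterE:
  fixes f :: "'a::metric_space \<Rightarrow> 'a"
  assumes f: "continuous_on UNIV f" and \<mu>: "\<mu> \<in> invariant_measures f"
    and t: "ereal t < metric_entropy f \<mu>"
  obtains c :: "'a \<Rightarrow> 'a set" where "simple_function borel c"
    "\<And>m. t * real m \<le> label_entropy \<mu> (word f c m)"
proof -
  obtain P where P: "P \<in> borel_partitions"
    and tP: "t < lim (\<lambda>n. partition_entropy \<mu> (iter_join f P n) / real n)"
    using t unfolding metric_entropy_def less_SUP_iff by auto
  define c where "c x = (THE A. A \<in> P \<and> x \<in> A)" for x
  have "\<Union>P = UNIV" "disjoint P" using P by (auto simp: borel_partitions_def)
  then have ex1: "\<exists>!A. A \<in> P \<and> x \<in> A" for x
    unfolding disjoint_def by (metis IntI UNIV_I Union_iff empty_iff)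
  have c: "c x \<in> P" "x \<in> c x" for x
    using theI'[OF ex1, of x] by (auto simp: c_def)
  have c_eq: "c x = A" if "A \<in> P" "x \<in> A" for x A
    using ex1[of x] c[of x] that by blast
  have fibre: "c -` {A} = A" if "A \<in> P" "A \<noteq> {}" for A
    using c c_eq that by blast
  have fin: "finite (range c)"
    using P c by (intro finite_subset[of "range c" P]) (auto simp: borel_partitions_def)
  have "c -` {c x} \<in> sets borel" for x
  proof -
    have "c -` {c x} = c x" using fibre[of "c x"] c[of x] by blast
    then show ?thesis using c(1)[of x] P by (auto simp: borel_partitions_def)
  qed
  then have simple: "simple_function borel c"
    using fin by (auto simp: simple_function_def)
  have "P - {{}} = range (\<lambda>x. c -` {c x})"
  proof (intro equalityI subsetI)
    fix A assume "A \<in> P - {{}}"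
    then obtain x where "x \<in> A" "A \<in> P" by blast
    then show "A \<in> range (\<lambda>x. c -` {c x})" using c_eq[of A x] fibre[of A] by (intro image_eqI[of _ _ x]) (metis empty_iff, simp)
  next
    fix A assume "A \<in> range (\<lambda>x. c -` {c x})"
    then obtain x where "A = c -` {c x}" by blast
    then show "A \<in> P - {{}}" using c[of x] fibre[of "c x"] by (metis Diff_iff emptyE singletonD)
  qed
  from partition_entropy_iter_join[OF invariant_measuresD(2)[OF \<mu>] fin this]
  have *: "partition_entropy \<mu> (iter_join f P n) = label_entropy \<mu> (word f c n)" for n .
  interpret prob_space \<mu> by (rule invariant_measuresD[OF \<mu>])
  have "t * real m \<le> label_entropy \<mu> (word f c m)" for m
  proof (cases "m = 0")
    case False
    have "t < (INF m\<in>{1..}. label_entropy \<mu> (word f c m) / real m)"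
      using tP unfolding * limI[OF label_entropy_word_limit[OF f \<mu> simple]] .
    also have "\<dots> \<le> label_entropy \<mu> (word f c m) / real m"
      using False by (intro cINF_lower bdd_belowI2[of _ 0]) (auto intro: divide_nonneg_nonneg label_entropy_nonneg)
    finally show ?thesis using False by (simp add: field_simps)
  qed (simp add: label_entropy_nonneg)
  with simple show ?thesis by (rule that)
qed

lemma metric_entropy_nonneg:
  assumes "continuous_on UNIV f" "\<mu> \<in> invariant_measures f"
  shows "0 \<le> metric_entropy f \<mu>"
proof -
  interpret prob_space \<mu> by (rule invariant_measuresD[OF assms(2)])
  show ?thesis
    using metric_entropy_geI[OF assms, of "\<lambda>_. ()" 0] by (auto simp: zero_ereal_def label_entropy_nonneg)
qed

lemma bounded_continuous_compact_UNIV: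
  fixes g :: "'a::metric_space \<Rightarrow> real"
  assumes "compact (UNIV :: 'a set)" "continuous_on UNIV g"
  obtains B where "B > 0" "\<And>x. \<bar>g x\<bar> \<le> B"
proof -
  have "bounded (range g)"
    using assms compact_continuous_image compact_imp_bounded by blast
  then show ?thesis using that unfolding bounded_pos by auto
qed

section \<open>Convex combinations of invariant measures\<close>

text \<open>The mixture is a two-stage experiment: a coin with bias \<open>p\<close> selects one of
  the two measures, then a point is drawn from it. The bind of this kernel supplies the probability
  measure and the rule for integrals.\<close>

lemma measure_mixture:
  fixes \<mu> \<nu> :: "'a::metric_space measure"
  assumes "sets \<mu> = sets borel" "prob_space \<mu>" "sets \<nu> = sets borel" "prob_space \<nu>"
    and p: "0 \<le> p" "p \<le> 1"
  obtains \<rho> where "sets \<rho> = sets borel" "prob_space \<rho>"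
    "\<And>A. A \<in> sets borel \<Longrightarrow> measure \<rho> A = p * measure \<mu> A + (1 - p) * measure \<nu> A"
    "\<And>g :: 'a \<Rightarrow> real. g \<in> borel_measurable borel \<Longrightarrow> bounded (range g) \<Longrightarrow>
       integral\<^sup>L \<rho> g = p * integral\<^sup>L \<mu> g + (1 - p) * integral\<^sup>L \<nu> g"
proof -
  interpret mu: prob_space \<mu> by fact
  interpret nu: prob_space \<nu> by fact
  define N where "N b = (if b then \<mu> else \<nu>)" for b
  let ?p = "measure_pmf (bernoulli_pmf p)"
  define \<rho> where "\<rho> = ?p \<bind> N"
  have N: "N \<in> measurable ?p (subprob_algebra borel)"
    using assms by (simp add: measurable_pmf_measure1 N_def space_subprob_algebra prob_space_imp_subprob_space)
  have Np: "prob_space (N b)" for b using assms by (simp add: N_def)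
  have "sets \<rho> = sets borel"
    unfolding \<rho>_def by (intro sets_bind[OF sets_kernel[OF N]]) auto
  moreover have "prob_space \<rho>"
    unfolding \<rho>_def using N Np by (intro measure_pmf.prob_space_bind) auto
  moreover have "measure \<rho> A = p * measure \<mu> A + (1 - p) * measure \<nu> A" if "A \<in> sets borel" for A
    unfolding \<rho>_def using that p
    by (subst measure_pmf.measure_bind[OF N]) (auto simp: N_def)
  moreover have "integral\<^sup>L \<rho> g = p * integral\<^sup>L \<mu> g + (1 - p) * integral\<^sup>L \<nu> g"
    if g: "g \<in> borel_measurable borel" "bounded (range g)" for g :: "'a \<Rightarrow> real"
  proof -
    obtain B where "\<And>x. \<bar>g x\<bar> \<le> B" using g(2) unfolding bounded_iff by auto
    then have "integral\<^sup>L \<rho> g = (\<integral>b. integral\<^sup>L (N b) g \<partial>?p)"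
      unfolding \<rho>_def using g(1) N Np
      by (intro integral_bind[where K=borel and B=B and B'=1])
        (auto simp: prob_space.emeasure_space_1 measure_pmf.finite_measure_axioms)
    also have "\<dots> = p * integral\<^sup>L \<mu> g + (1 - p) * integral\<^sup>L \<nu> g"
      using p by (simp add: N_def)
    finally show ?thesis .
  qed
  ultimately show ?thesis by (rule that)
qed

text \<open>The last clause is the concavity half of the affinity of entropy, phrased with strict
  real lower bounds so that infinite entropies are covered. Labellings with rates at least
  \<open>a\<close> and \<open>b\<close> are paired into one, and concavity of label entropy is
  applied to the joint words.\<close>

lemma invariant_mixture:
  fixes f :: "'a::metric_space \<Rightarrow> 'a"
  assumes X: "compact (UNIV :: 'a set)" and f: "continuous_on UNIV f"
    and \<mu>: "\<mu> \<in> invariant_measures f" and \<nu>: "\<nu> \<in> invariant_measures f"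
    and p: "0 \<le> p" "p \<le> 1"
  obtains \<rho> where "\<rho> \<in> invariant_measures f"
    "\<And>A. A \<in> sets borel \<Longrightarrow> measure \<rho> A = p * measure \<mu> A + (1 - p) * measure \<nu> A"
    "\<And>g :: 'a \<Rightarrow> real. continuous_on UNIV g \<Longrightarrow>
       integral\<^sup>L \<rho> g = p * integral\<^sup>L \<mu> g + (1 - p) * integral\<^sup>L \<nu> g"
    "\<And>a b. ereal a < metric_entropy f \<mu> \<Longrightarrow> ereal b < metric_entropy f \<nu> \<Longrightarrow>
       ereal (p * a + (1 - p) * b) \<le> metric_entropy f \<rho>"
proof -
  note \<mu>' = invariant_measuresD[OF \<mu>] and \<nu>' = invariant_measuresD[OF \<nu>]
  obtain \<rho> where \<rho>: "sets \<rho> = sets borel" "prob_space \<rho>"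
    and m: "\<And>A. A \<in> sets borel \<Longrightarrow> measure \<rho> A = p * measure \<mu> A + (1 - p) * measure \<nu> A"
    and i: "\<And>g :: 'a \<Rightarrow> real. g \<in> borel_measurable borel \<Longrightarrow> bounded (range g) \<Longrightarrow>
       integral\<^sup>L \<rho> g = p * integral\<^sup>L \<mu> g + (1 - p) * integral\<^sup>L \<nu> g"
    by (rule measure_mixture[OF \<mu>'(1,3) \<nu>'(1,3) p]) (rule that; blast)
  interpret rho: prob_space \<rho> by fact
  interpret mu: prob_space \<mu> by fact
  interpret nu: prob_space \<nu> by fact
  have sp: "space \<rho> = UNIV" using sets_eq_imp_space_eq[OF \<rho>(1)] by simp
  have inv: "\<rho> \<in> invariant_measures f"
    unfolding invariant_measures_def
  proof (intro CollectI conjI ballI \<rho>)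
    fix A :: "'a set" assume A: "A \<in> sets borel"
    then have "f -` A \<in> sets borel" using vimage_funpow_borel[OF f A, of 1] by simp
    then show "emeasure \<rho> (f -` A) = emeasure \<rho> A"
      using A \<mu>'(4)[OF A] \<nu>'(4)[OF A] m by (simp add: rho.emeasure_eq_measure)
  qed
  have ent: "ereal (p * a + (1 - p) * b) \<le> metric_entropy f \<rho>"
    if a: "ereal a < metric_entropy f \<mu>" and b: "ereal b < metric_entropy f \<nu>" for a b
  proof -
    obtain c :: "'a \<Rightarrow> 'a set" where c: "simple_function borel c" "\<And>m. a * real m \<le> label_entropy \<mu> (word f c m)"
      by (rule metric_entropy_greaterE[OF f \<mu> a]) (rule that)
    obtain d :: "'a \<Rightarrow> 'a set" where d: "simple_function borel d" "\<And>m. b * real m \<le> label_entropy \<nu> (word f d m)"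
      by (rule metric_entropy_greaterE[OF f \<nu> b]) (rule that)
    define e where "e x = (c x, d x)" for x
    have e: "simple_function borel e" unfolding e_def by (intro simple_function_Pair c d)
    have we: "simple_function borel (word f e n)" for n by (intro simple_function_word_borel f e)
    have eF: "word f c n x = map fst (word f e n x)" "word f d n x = map snd (word f e n x)" for n x
      by (auto simp: word_def e_def)
    show ?thesis
    proof (rule metric_entropy_geI[OF f inv e])
      fix n :: nat
      have "a * real n \<le> label_entropy \<mu> (word f e n)"
        using c(2)[of n] mu.label_entropy_compose_le[of "word f e n" "map fst"] we
        by (simp add: simple_function_borel_cong[OF \<mu>'(1)] flip: eF)
      moreover have "b * real n \<le> label_entropy \<nu> (word f e n)"
        using d(2)[of n] nu.label_entropy_compose_le[of "word f e n" "map snd"] we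
        by (simp add: simple_function_borel_cong[OF \<nu>'(1)] flip: eF)
      ultimately have "p * (a * real n) + (1 - p) * (b * real n) \<le>
          p * label_entropy \<mu> (word f e n) + (1 - p) * label_entropy \<nu> (word f e n)"
        using p by (intro add_mono mult_left_mono) auto
      also have "\<dots> = (\<Sum>i\<in>(UNIV::bool set). (if i then p else 1 - p) *
          label_entropy (if i then \<mu> else \<nu>) (word f e n))"
        by (simp add: UNIV_bool)
      also have "\<dots> \<le> label_entropy \<rho> (word f e n)"
      proof (rule label_entropy_concave[where S="range (word f e n)"])
        show "measure \<rho> (word f e n -` {l} \<inter> space \<rho>) =
          (\<Sum>i\<in>UNIV. (if i then p else 1 - p) *
            measure (if i then \<mu> else \<nu>) (word f e n -` {l} \<inter> space (if i then \<mu> else \<nu>)))" for l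
          using m[of "word f e n -` {l}"] simple_functionD(2)[OF we, of n "{l}"]
          by (simp add: UNIV_bool sp \<mu>'(2) \<nu>'(2))
        show "finite (range (word f e n))" using simple_functionD(1)[OF we] by simp
      qed (use p in \<open>auto simp: UNIV_bool split: if_splits\<close>)
      finally show "(p * a + (1 - p) * b) * real n \<le> label_entropy \<rho> (word f e n)"
        by (simp add: algebra_simps)
    qed
  qed
  show ?thesis
  proof (rule that[OF inv m _ ent])
    fix g :: "'a \<Rightarrow> real" assume g: "continuous_on UNIV g"
    have "bounded (range g)"
      using X g compact_continuous_image compact_imp_bounded by blast
    then show "integral\<^sup>L \<rho> g = p * integral\<^sup>L \<mu> g + (1 - p) * integral\<^sup>L \<nu> g"
      by (intro i borel_measurable_continuous_onI g)
  qed
qed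

section \<open>Weak compactness\<close>

text \<open>The sequence enumerates the balls of finite nets of radius \<open>1 / Suc k\<close> for
  all \<open>k\<close>. Points that agree on the balls of one net share a ball of it, so their
  distance is below \<open>2 / Suc k\<close>; finitely many indices exhaust that net.\<close>

lemma compact_separating_sequence:
  assumes X: "compact (UNIV :: 'a::metric_space set)"
  obtains U :: "nat \<Rightarrow> 'a::metric_space set" where "\<And>i. open (U i)"
    "\<And>e. e > 0 \<Longrightarrow> \<exists>m. \<forall>x y. (\<forall>i\<le>m. x \<in> U i \<longleftrightarrow> y \<in> U i) \<longrightarrow> dist x y < e"
proof -
  have "\<exists>F :: 'a set. finite F \<and> UNIV \<subseteq> (\<Union>x\<in>F. ball x (1 / real (Suc k)))" for k
    using seq_compact_imp_totally_bounded[OF X[unfolded compact_eq_seq_compact_metric]]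
    by (meson of_nat_0_less_iff zero_less_Suc zero_less_divide_1_iff)
  then obtain F :: "nat \<Rightarrow> 'a set" where F: "\<And>k. finite (F k)"
    "\<And>k. UNIV \<subseteq> (\<Union>x\<in>F k. ball x (1 / real (Suc k)))" by metis
  define \<U> where "\<U> = (\<Union>k. (\<lambda>x. ball x (1 / real (Suc k))) ` F k)"
  have "F 0 \<noteq> {}" using F(2)[of 0] by auto
  then have ne: "\<U> \<noteq> {}" by (auto simp: \<U>_def)
  have cnt: "countable \<U>" unfolding \<U>_def using F(1) by (intro countable_UN) (auto intro: countable_finite)
  have ran: "range (from_nat_into \<U>) = \<U>" using ne cnt by (rule range_from_nat_into)
  show ?thesis
  proof (rule that[of "from_nat_into \<U>"])
    show "open (from_nat_into \<U> i)" for i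
    proof -
      have "from_nat_into \<U> i \<in> \<U>" by (rule from_nat_into[OF ne])
      then show ?thesis by (auto simp: \<U>_def)
    qed
    fix e :: real assume "e > 0"
    then obtain k :: nat where k: "2 / e < real (Suc k)"
      using reals_Archimedean2[of "2 / e"] by (metis less_Suc_eq_0_disj lessI of_nat_less_iff order.strict_trans)
    have "(\<lambda>x. ball x (1 / real (Suc k))) ` F k \<subseteq> range (from_nat_into \<U>)"
      unfolding ran by (auto simp: \<U>_def)
    then obtain J where J: "finite J" "(\<lambda>x. ball x (1 / real (Suc k))) ` F k = from_nat_into \<U> ` J"
      using F(1) by (metis finite_imageI finite_subset_image)
    obtain m where m: "\<forall>j\<in>J. j \<le> m" using J(1) finite_nat_set_iff_bounded_le by blast
    show "\<exists>m. \<forall>x y. (\<forall>i\<le>m. x \<in> from_nat_into \<U> i \<longleftrightarrow> y \<in> from_nat_into \<U> i) \<longrightarrow> dist x y < e"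
    proof (intro exI allI impI)
      fix x y assume xy: "\<forall>i\<le>m. x \<in> from_nat_into \<U> i \<longleftrightarrow> y \<in> from_nat_into \<U> i"
      obtain z where z: "z \<in> F k" "x \<in> ball z (1 / real (Suc k))" using F(2)[of k] by blast
      then obtain j where j: "j \<in> J" "ball z (1 / real (Suc k)) = from_nat_into \<U> j" using J(2) by blast
      have "y \<in> from_nat_into \<U> j" using xy m j z(2) by blast
      then have "dist z y < 1 / real (Suc k)" unfolding j(2)[symmetric] by simp
      then have "dist x y < 1 / real (Suc k) + 1 / real (Suc k)"
        using z(2) dist_triangle[of x y z] by (simp add: dist_commute)
      also have "\<dots> \<le> e" using k \<open>e > 0\<close> by (simp add: field_simps)
      finally show "dist x y < e" .
    qed
  qed
qed

text \<open>At the first differing digit \<open>k\<close> the difference is \<open>(1/3)^k\<close>,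
  while all later digits together contribute at most \<open>(1/3)^k / 2\<close>. Base 2 would leave
  no gap, because of double expansions.\<close>

lemma ternary_expansion_gap:
  fixes a b :: "nat \<Rightarrow> real"
  assumes a: "\<And>i. a i \<in> {0, 1}" and b: "\<And>i. b i \<in> {0, 1}"
    and close: "\<bar>(\<Sum>i. a i * (1/3)^i) - (\<Sum>i. b i * (1/3)^i)\<bar> < (1/3)^m / 2" and "i \<le> m"
  shows "a i = b i"
proof (rule ccontr)
  assume "a i \<noteq> b i"
  define k where "k = (LEAST i. a i \<noteq> b i)"
  have k: "a k \<noteq> b k" "k \<le> i"
    unfolding k_def by (rule LeastI, fact, rule Least_le, fact)
  have k_less: "a j = b j" if "j < k" for j
    using not_less_Least[OF that[unfolded k_def]] by blast
  have geo: "summable (\<lambda>i. (1/3)^i :: real)" by (simp add: summable_geometric)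
  have sum: "summable (\<lambda>i. c i * (1/3)^i)" if "\<And>i. c i \<in> {0, 1}" for c :: "nat \<Rightarrow> real"
  proof (intro summable_comparison_test[OF _ geo] exI[of _ 0] allI impI)
    fix n show "norm (c n * (1/3)^n) \<le> (1/3)^n" using that[of n] by auto
  qed
  define d where "d i = (a i - b i) * (1/3)^i" for i
  have d_le: "\<bar>d i\<bar> \<le> (1/3)^i" for i
    using a[of i] b[of i] by (auto simp: d_def)
  have sd: "summable d"
    unfolding d_def using summable_diff[OF sum[OF a] sum[OF b]] by (simp add: algebra_simps)
  have "(\<Sum>i. a i * (1/3)^i) - (\<Sum>i. b i * (1/3)^i) = suminf d"
    unfolding d_def by (subst suminf_diff[OF sum[OF a] sum[OF b]]) (simp add: algebra_simps)
  also have "\<dots> = (\<Sum>i. d (i + Suc k)) + d k"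
    using suminf_split_initial_segment[OF sd, of "Suc k"] k_less by (simp add: d_def)
  finally have eq: "(\<Sum>i. a i * (1/3)^i) - (\<Sum>i. b i * (1/3)^i) = (\<Sum>i. d (i + Suc k)) + d k" .
  have geo': "(\<lambda>i. (1/3)^(i + Suc k)) sums ((1/3)^k / 2 :: real)"
    using sums_mult[OF geometric_sums[of "1/3::real"], of "(1/3)^Suc k"] by (simp add: power_add mult.commute)
  have "norm (d (i + Suc k)) \<le> (1/3)^(i + Suc k)" for i
    using d_le[of "i + Suc k"] by (simp only: real_norm_def)
  from norm_suminf_le[OF this sums_summable[OF geo']]
  have "\<bar>\<Sum>i. d (i + Suc k)\<bar> \<le> (\<Sum>i. (1/3)^(i + Suc k))"
    by (simp only: real_norm_def)
  then have "\<bar>\<Sum>i. d (i + Suc k)\<bar> \<le> (1/3)^k / 2" using sums_unique[OF geo'] by simp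
  moreover have "\<bar>d k\<bar> = (1/3)^k" using a[of k] b[of k] k(1) by (auto simp: d_def)
  ultimately have "(1/3)^k / 2 \<le> \<bar>(\<Sum>i. a i * (1/3)^i) - (\<Sum>i. b i * (1/3)^i)\<bar>"
    unfolding eq by linarith
  moreover have "(1/3 :: real)^m \<le> (1/3)^k" using k(2) \<open>i \<le> m\<close> by (intro power_decreasing) auto
  ultimately show False using close by linarith
qed

text \<open>The inverse of s, unlike s, is uniformly continuous, so it extends to a continuous
  map from a compact set of reals onto the space. This transports Helly's selection theorem to
  compact metric spaces and avoids the Riesz representation theorem.\<close>

lemma compact_real_coding:
  assumes X: "compact (UNIV :: 'a::metric_space set)"
  obtains s :: "'a::metric_space \<Rightarrow> real" where "s \<in> borel_measurable borel" "\<And>x. 0 \<le> s x \<and> s x \<le> 3/2"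
    "\<And>e. e > 0 \<Longrightarrow> \<exists>d>0. \<forall>x y. \<bar>s x - s y\<bar> < d \<longrightarrow> dist x y < e"
proof -
  obtain U :: "nat \<Rightarrow> 'a set" where U: "\<And>i. open (U i)"
    and sep: "\<And>e. e > 0 \<Longrightarrow> \<exists>m. \<forall>x y. (\<forall>i\<le>m. x \<in> U i \<longleftrightarrow> y \<in> U i) \<longrightarrow> dist x y < e"
    using compact_separating_sequence[OF X] by metis
  \<comment> \<open>The i-th ternary digit records membership in \<open>U i\<close>; exponents start
    at 0, which gives the upper bound 3/2.\<close>
  define s :: "'a \<Rightarrow> real" where "s x = (\<Sum>i. indicator (U i) x * (1/3)^i)" for x
  have geo: "(\<lambda>i. (1/3)^i) sums (3/2 :: real)" using geometric_sums[of "1/3::real"] by simp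
  have sum: "summable (\<lambda>i. indicator (U i) x * (1/3)^i :: real)" for x
    using sums_summable[OF geo]
    by (intro summable_comparison_test[OF _ sums_summable[OF geo]] exI[of _ 0]) (auto simp: indicator_def)
  have meas: "s \<in> borel_measurable borel"
    unfolding s_def using U
    by (intro borel_measurable_suminf borel_measurable_times borel_measurable_indicator borel_open) auto
  moreover have "0 \<le> s x \<and> s x \<le> 3/2" for x
  proof
    show "0 \<le> s x" unfolding s_def by (intro suminf_nonneg sum) auto
    have "s x \<le> (\<Sum>i. (1/3)^i)"
      unfolding s_def by (intro suminf_le sum sums_summable[OF geo]) (auto simp: indicator_def)
    then show "s x \<le> 3/2" using sums_unique[OF geo] by simp
  qed
  moreover have "\<exists>d>0. \<forall>x y. \<bar>s x - s y\<bar> < d \<longrightarrow> dist x y < e" if e: "e > 0" for e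
  proof -
    obtain m where m: "\<forall>x y. (\<forall>i\<le>m. x \<in> U i \<longleftrightarrow> y \<in> U i) \<longrightarrow> dist x y < e"
      using sep[OF e] by blast
    show ?thesis
    proof (intro exI[of _ "(1/3)^m / 2"] conjI allI impI)
      fix x y assume *: "\<bar>s x - s y\<bar> < (1/3)^m / 2"
      have "x \<in> U i \<longleftrightarrow> y \<in> U i" if "i \<le> m" for i
      proof -
        have "indicator (U i) x = (indicator (U i) y :: real)"
          using * that unfolding s_def by (intro ternary_expansion_gap[of "\<lambda>i. indicator (U i) x" "\<lambda>i. indicator (U i) y" m])
            (auto simp: indicator_def)
        then show ?thesis by (auto simp: indicator_def split: if_splits)
      qed
      with m show "dist x y < e" by blast
    qed simp
  qed
  ultimately show ?thesis by (rule that)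
qed

lemma compact_inverse_extension:
  fixes s :: "'a::metric_space \<Rightarrow> real"
  assumes X: "compact (UNIV :: 'a set)"
    and s: "\<And>e. e > 0 \<Longrightarrow> \<exists>d>0. \<forall>x y. \<bar>s x - s y\<bar> < d \<longrightarrow> dist x y < e"
  obtains h where "continuous_on (closure (range s)) h" "\<And>x. h (s x) = x"
proof -
  \<comment> \<open>\<open>R y x\<close> says that points coded near \<open>y\<close> lie near
    \<open>x\<close>. Compactness yields such an \<open>x\<close> for each \<open>y\<close> in the
    closure, and the uniform hypothesis on \<open>s\<close> makes it a limit along all codes near
    \<open>y\<close>, not merely along one sequence.\<close>
  define R where "R y x \<longleftrightarrow> (\<forall>e>0. \<exists>d>0. \<forall>z. \<bar>s z - y\<bar> < d \<longrightarrow> dist z x < e)" for y x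
  have ex: "\<exists>x. R y x" if y: "y \<in> closure (range s)" for y
  proof -
    have "\<exists>z. \<bar>s z - y\<bar> < 1 / real (Suc n)" for n
    proof -
      obtain w where "w \<in> range s" "dist w y < 1 / real (Suc n)"
        using y unfolding closure_approachable by (meson of_nat_0_less_iff zero_less_Suc zero_less_divide_1_iff)
      then show ?thesis by (auto simp: dist_real_def)
    qed
    then obtain z where z: "\<And>n. \<bar>s (z n) - y\<bar> < 1 / real (Suc n)" by metis
    obtain x r where r: "strict_mono r" "(z \<circ> r) \<longlonglongrightarrow> x"
      using X unfolding compact_def by blast
    have "R y x" unfolding R_def
    proof (intro allI impI)
      fix e :: real assume "e > 0"
      then obtain d where d: "d > 0" "\<forall>x y. \<bar>s x - s y\<bar> < d \<longrightarrow> dist x y < e / 2" using s[of "e/2"] by auto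
      obtain N where N: "\<And>n. n \<ge> N \<Longrightarrow> dist (z (r n)) x < e / 2"
        using r(2) \<open>e > 0\<close> unfolding lim_sequentially comp_def by (meson half_gt_zero)
      obtain M :: nat where M: "2 / d < real M" using reals_Archimedean2 by blast
      define n where "n = max N M"
      have "real M \<le> real (Suc (r n))" using seq_suble[OF r(1), of n] by (simp add: n_def)
      then have "2 / d < real (Suc (r n))" using M by linarith
      then have "1 / real (Suc (r n)) < d / 2" using d(1) by (simp add: field_simps)
      then have zn: "\<bar>s (z (r n)) - y\<bar> < d / 2" using z[of "r n"] by linarith
      show "\<exists>d>0. \<forall>z. \<bar>s z - y\<bar> < d \<longrightarrow> dist z x < e"
      proof (intro exI[of _ "d/2"] conjI allI impI)
        fix w assume "\<bar>s w - y\<bar> < d / 2"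
        then have "\<bar>s w - s (z (r n))\<bar> < d" using zn by linarith
        then have "dist w (z (r n)) < e / 2" using d by blast
        then show "dist w x < e" using N[of n] dist_triangle_half_r[of "z (r n)" w e x]
          by (simp add: n_def dist_commute)
      qed (use d in simp)
    qed
    then show ?thesis by blast
  qed
  define h where "h y = (SOME x. R y x)" for y
  have h: "R y (h y)" if "y \<in> closure (range s)" for y
    unfolding h_def using ex[OF that] by (rule someI_ex)
  show ?thesis
  proof (rule that[of h])
    fix x
    have "s x \<in> closure (range s)" using closure_subset[of "range s"] by auto
    then have R: "R (s x) (h (s x))" by (rule h)
    have "dist x (h (s x)) < e" if "e > 0" for e
    proof -
      obtain d where d: "d > 0" "\<forall>z. \<bar>s z - s x\<bar> < d \<longrightarrow> dist z (h (s x)) < e"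
        using R \<open>e > 0\<close> unfolding R_def by blast
      show ?thesis using d(1) d(2)[rule_format, of x] by simp
    qed
    from this[of "dist x (h (s x))"] show "h (s x) = x" by (cases "h (s x) = x") auto
  next
    show "continuous_on (closure (range s)) h"
      unfolding continuous_on_iff
    proof (intro ballI allI impI)
      fix y e assume y: "y \<in> closure (range s)" and "(e::real) > 0"
      then obtain d where d: "d > 0" "\<And>z. \<bar>s z - y\<bar> < d \<Longrightarrow> dist z (h y) < e / 2"
        using h[OF y] unfolding R_def by (meson half_gt_zero)
      show "\<exists>d>0. \<forall>y'\<in>closure (range s). dist y' y < d \<longrightarrow> dist (h y') (h y) < e"
      proof (intro exI[of _ "d/2"] conjI ballI impI)
        fix y' assume y': "y' \<in> closure (range s)" "dist y' y < d / 2"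
        obtain d' where d': "d' > 0" "\<And>z. \<bar>s z - y'\<bar> < d' \<Longrightarrow> dist z (h y') < e / 2"
          using h[OF y'(1)] \<open>e > 0\<close> unfolding R_def by (meson half_gt_zero)
        obtain z where z: "\<bar>s z - y'\<bar> < min d' (d / 2)"
        proof -
          have "0 < min d' (d / 2)" using d d' by simp
          then obtain w where "w \<in> range s" "dist w y' < min d' (d / 2)"
            using y'(1) unfolding closure_approachable by meson
          then show ?thesis using that by (auto simp: dist_real_def)
        qed
        then have "\<bar>s z - y\<bar> < d" using y'(2) unfolding dist_real_def min_less_iff_conj by linarith
        then have "dist z (h y) < e / 2" by (rule d)
        moreover have "dist z (h y') < e / 2" using z by (intro d') simp
        ultimately show "dist (h y') (h y) < e"
          using dist_triangle_half_r[of z "h y'" e "h y"] by simp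
      qed (use d in simp)
    qed
  qed
qed

lemma integrable_continuous_compact_UNIV:
  fixes g :: "'a::metric_space \<Rightarrow> real"
  assumes "compact (UNIV :: 'a set)" "continuous_on UNIV g" "sets \<mu> = sets borel" "prob_space \<mu>"
  shows "integrable \<mu> g"
proof -
  interpret prob_space \<mu> by fact
  have [measurable]: "g \<in> borel_measurable \<mu>"
    using borel_measurable_continuous_onI[OF assms(2)] measurable_cong_sets[OF assms(3) refl] by blast
  obtain B where "\<And>x. \<bar>g x\<bar> \<le> B" using bounded_continuous_compact_UNIV[OF assms(1,2)] by blast
  then show ?thesis by (intro integrable_const_bound[of _ B]) auto
qed

text \<open>The measures are pushed to the line by \<open>s\<close>, where all of them live in one
  bounded interval, so a subsequence has a limit \<open>N\<close>; the continuous inverse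
  \<open>h\<close> carries \<open>N\<close> back. A test function \<open>g\<close> becomes
  \<open>g (h y)\<close> on the codes, extended from \<open>C\<close> to the line by Tietze with the
  same bound.\<close>

theorem compact_prob_space_weak_limit:
  fixes \<mu>s :: "nat \<Rightarrow> 'a::metric_space measure"
  assumes X: "compact (UNIV :: 'a set)"
    and \<mu>s: "\<And>n. sets (\<mu>s n) = sets borel" "\<And>n. prob_space (\<mu>s n)"
  obtains r \<mu> where "strict_mono r" "sets \<mu> = sets borel" "prob_space \<mu>" "weak_conv (\<mu>s \<circ> r) \<mu>"
proof -
  obtain s :: "'a \<Rightarrow> real" where s: "s \<in> borel_measurable borel" "\<And>x. 0 \<le> s x \<and> s x \<le> 3/2"
    "\<And>e. e > 0 \<Longrightarrow> \<exists>d>0. \<forall>x y. \<bar>s x - s y\<bar> < d \<longrightarrow> dist x y < e"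
    using compact_real_coding[OF X] by metis
  obtain h where h: "continuous_on (closure (range s)) h" "\<And>x. h (s x) = x"
    using compact_inverse_extension[OF X s(3)] by metis
  define C where "C = closure (range s)"
  have C: "closed C" "s x \<in> C" for x using closure_subset[of "range s"] by (auto simp: C_def)
  have "C \<noteq> {}" using C(2) by blast
  define \<nu> where "\<nu> n = distr (\<mu>s n) borel s" for n
  have sm: "s \<in> borel_measurable (\<mu>s n)" for n
    using s(1) measurable_cong_sets[OF \<mu>s(1) refl] by blast
  have \<nu>: "real_distribution (\<nu> n)" for n
    unfolding \<nu>_def using prob_space.real_distribution_distr[OF \<mu>s(2) sm] .
  have full: "measure (\<nu> n) {-1<..2} = 1" for n
  proof -
    interpret prob_space "\<mu>s n" by (rule \<mu>s)
    have "s -` {-1<..2} \<inter> space (\<mu>s n) = space (\<mu>s n)"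
    proof -
      have "-1 < s x \<and> s x \<le> 2" for x using s(2)[of x] by linarith
      then show ?thesis by auto
    qed
    then show ?thesis unfolding \<nu>_def by (subst measure_distr[OF sm]) (auto simp: prob_space)
  qed
  have "tight \<nu>" unfolding tight_def
  proof (intro conjI allI impI \<nu>)
    fix e :: real assume "e > 0"
    then show "\<exists>a b. a < b \<and> (\<forall>n. 1 - e < measure (\<nu> n) {a<..b})"
      using full by (intro exI[of _ "-1"] exI[of _ 2]) auto
  qed
  from tight_imp_convergent_subsubsequence[OF this strict_mono_id]
  obtain r N where r: "strict_mono r" "real_distribution N" "weak_conv_m (\<nu> \<circ> r) N"
    by (auto simp: comp_def)
  interpret N: real_distribution N by fact
  have conv: "(\<lambda>n. integral\<^sup>L (\<nu> (r n)) g) \<longlonglongrightarrow> integral\<^sup>L N g"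
    if "continuous_on UNIV g" "\<And>x. \<bar>g x\<bar> \<le> B" for g :: "real \<Rightarrow> real" and B
    using weak_conv_imp_integral_bdd_continuous_conv[of "\<nu> \<circ> r" N g B] r \<nu> that
    by (auto simp: continuous_on_eq_continuous_at)
  have int\<nu>: "integral\<^sup>L (\<nu> n) g = (\<integral>x. g (s x) \<partial>\<mu>s n)" if "continuous_on UNIV g" for g :: "real \<Rightarrow> real" and n
    unfolding \<nu>_def using that by (intro integral_distr sm borel_measurable_continuous_onI)
  \<comment> \<open>\<open>min 1 (infdist y C)\<close> is bounded, continuous and zero on all codes,
    so its integral against every \<open>\<nu> n\<close>, hence against the limit, is 0: the limit
    is concentrated on \<open>C\<close>.\<close>
  have AEC: "AE y in N. y \<in> C"
  proof -
    define g where "g y = min 1 (infdist y C)" for y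
    have g: "continuous_on UNIV g" unfolding g_def by (intro continuous_intros)
    have g01: "0 \<le> g y" "\<bar>g y\<bar> \<le> 1" for y by (auto simp: g_def infdist_nonneg)
    have "integral\<^sup>L (\<nu> n) g = 0" for n
      unfolding int\<nu>[OF g] using C by (simp add: g_def)
    with conv[OF g g01(2)] have "integral\<^sup>L N g = 0" by (simp add: LIMSEQ_const_iff)
    moreover have [measurable]: "g \<in> borel_measurable borel" by (intro borel_measurable_continuous_onI g)
    moreover have "integrable N g"
      using g01 by (intro N.integrable_const_bound[of _ 1]) auto
    ultimately have "AE y in N. g y = 0"
      using integral_nonneg_eq_0_iff_AE[of N g] g01 by auto
    then show ?thesis
    proof (rule AE_mp, intro AE_I2 impI)
      fix y assume "g y = 0"
      then have "infdist y C = 0" by (auto simp: g_def min_def split: if_splits)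
      then show "y \<in> C" using C \<open>C \<noteq> {}\<close> in_closed_iff_infdist_zero by blast
    qed
  qed
  \<comment> \<open>Off \<open>C\<close>, where \<open>N\<close> has no mass, an arbitrary constant
    keeps \<open>p\<close> measurable.\<close>
  define p where "p y = (if y \<in> C then h y else h (s undefined))" for y
  have pm: "p \<in> borel_measurable borel"
    unfolding p_def using h(1) C by (intro borel_measurable_continuous_on_if) (auto simp: C_def)
  then have pN: "p \<in> measurable N borel" by simp
  define \<mu> where "\<mu> = distr N borel p"
  have "prob_space \<mu>" unfolding \<mu>_def by (intro N.prob_space_distr pN)
  moreover have "weak_conv (\<mu>s \<circ> r) \<mu>"
    unfolding weak_conv_def
  proof (intro allI impI)
    fix g :: "'a \<Rightarrow> real" assume g: "continuous_on UNIV g"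
    obtain B where B: "B > 0" "\<And>x. \<bar>g x\<bar> \<le> B" using bounded_continuous_compact_UNIV[OF X g] by blast
    have "continuous_on C (\<lambda>y. g (h y))"
      using h(1) g unfolding C_def by (metis continuous_on_compose2 subset_UNIV)
    then obtain G where G: "continuous_on UNIV G" "\<And>y. y \<in> C \<Longrightarrow> G y = g (h y)" "\<And>y. \<bar>G y\<bar> \<le> B"
      using Tietze[of C "\<lambda>y. g (h y)" UNIV B] C B by (auto simp: less_imp_le)
    have "integral\<^sup>L (\<mu>s n) g = integral\<^sup>L (\<nu> n) G" for n
      unfolding int\<nu>[OF G(1)] using G(2) C(2) h(2) by simp
    moreover have "integral\<^sup>L \<mu> g = integral\<^sup>L N G"
    proof -
      have "integral\<^sup>L \<mu> g = (\<integral>y. g (p y) \<partial>N)"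
        unfolding \<mu>_def by (intro integral_distr pN borel_measurable_continuous_onI g)
      also have "\<dots> = integral\<^sup>L N G"
      proof (rule integral_cong_AE)
        show "(\<lambda>y. g (p y)) \<in> borel_measurable N"
          using measurable_compose[OF pN borel_measurable_continuous_onI[OF g]] .
        show "G \<in> borel_measurable N" using borel_measurable_continuous_onI[OF G(1)] by simp
        show "AE y in N. g (p y) = G y"
          using AEC by (rule AE_mp) (auto simp: p_def G)
      qed
      finally show ?thesis .
    qed
    ultimately show "(\<lambda>n. integral\<^sup>L ((\<mu>s \<circ> r) n) g) \<longlonglongrightarrow> integral\<^sup>L \<mu> g"
      using conv[OF G(1,3)] by simp
  qed
  ultimately show ?thesis using that[OF r(1), of \<mu>] by (simp add: \<mu>_def)
qed

section \<open>Weak convergence tested on sets\<close>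

text \<open>The integrands decrease to the indicator of \<open>F\<close>. For empty \<open>F\<close>
  the function \<open>infdist\<close> is 0 by convention and they would all be 1, hence the
  exclusion.\<close>

lemma continuous_approx_closed:
  fixes F :: "'a::metric_space set"
  assumes F: "closed F" "F \<noteq> {}" and \<mu>: "sets \<mu> = sets borel" "prob_space \<mu>"
  shows "(\<lambda>j. \<integral>x. max 0 (1 - real j * infdist x F) \<partial>\<mu>) \<longlonglongrightarrow> measure \<mu> F"
proof -
  interpret prob_space \<mu> by fact
  have m: "(\<lambda>x. max 0 (1 - real j * infdist x F)) \<in> borel_measurable \<mu>" for j
    unfolding measurable_cong_sets[OF \<mu>(1) refl]
    by (intro borel_measurable_continuous_onI continuous_intros)
  have [measurable]: "F \<in> sets \<mu>" using F \<mu> by simp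
  have "(\<lambda>j. \<integral>x. max 0 (1 - real j * infdist x F) \<partial>\<mu>) \<longlonglongrightarrow> (\<integral>x. indicator F x \<partial>\<mu>)"
  proof (rule integral_dominated_convergence[where w="\<lambda>_. 1"])
    show "AE x in \<mu>. (\<lambda>j. max 0 (1 - real j * infdist x F)) \<longlonglongrightarrow> indicator F x"
    proof (rule AE_I2)
      fix x
      show "(\<lambda>j. max 0 (1 - real j * infdist x F)) \<longlonglongrightarrow> indicator F x"
      proof (cases "x \<in> F")
        case False
        then have d: "infdist x F > 0" using F by (simp add: infdist_pos_not_in_closed)
        obtain N :: nat where N: "1 / infdist x F < real N" using reals_Archimedean2 by blast
        have "max 0 (1 - real j * infdist x F) = 0" if "j \<ge> N" for j
        proof -
          have "1 / infdist x F < real j" using N that by linarith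
          then show ?thesis using d by (simp add: field_simps)
        qed
        then show ?thesis using False by (intro tendsto_eventually) (auto simp: eventually_sequentially)
      qed simp
    qed
  qed (use m in \<open>auto simp: infdist_nonneg abs_if\<close>)
  then show ?thesis by simp
qed

lemma prob_measure_eqI_continuous:
  fixes \<mu> \<nu> :: "'a::metric_space measure"
  assumes \<mu>: "sets \<mu> = sets borel" "prob_space \<mu>" and \<nu>: "sets \<nu> = sets borel" "prob_space \<nu>"
    and eq: "\<And>g :: 'a \<Rightarrow> real. continuous_on UNIV g \<Longrightarrow> integral\<^sup>L \<mu> g = integral\<^sup>L \<nu> g"
  shows "\<mu> = \<nu>"
proof (rule measure_eqI_generator_eq[where E="Collect closed" and \<Omega>=UNIV and A="\<lambda>_. UNIV"])
  interpret mu: prob_space \<mu> by fact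
  interpret nu: prob_space \<nu> by fact
  show "emeasure \<mu> F = emeasure \<nu> F" if "F \<in> Collect closed" for F
  proof (cases "F = {}")
    case False
    have "(\<lambda>j. \<integral>x. max 0 (1 - real j * infdist x F) \<partial>\<mu>) = (\<lambda>j. \<integral>x. max 0 (1 - real j * infdist x F) \<partial>\<nu>)"
      by (intro ext eq continuous_intros)
    with continuous_approx_closed[OF _ False \<mu>] continuous_approx_closed[OF _ False \<nu>] that
    have "measure \<mu> F = measure \<nu> F" using LIMSEQ_unique by auto
    then show ?thesis by (simp add: mu.emeasure_eq_measure nu.emeasure_eq_measure)
  qed simp
  show "sets \<mu> = sigma_sets UNIV (Collect closed)" "sets \<nu> = sigma_sets UNIV (Collect closed)"
    unfolding \<mu>(1) \<nu>(1) by (simp_all add: borel_eq_closed)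
  show "emeasure \<mu> UNIV \<noteq> \<infinity>" by (simp add: mu.emeasure_eq_measure)
qed (simp_all add: Int_stable_def closed_Int)

text \<open>The null frontier allows \<open>A\<close> to be replaced by its closure
  \<open>F\<close>; a continuous majorant of the indicator of \<open>F\<close> with nearly the same
  \<mu>-integral then transfers the bound to \<open>\<mu>s n\<close>.\<close>

lemma portmanteau_upper:
  fixes \<mu> :: "'a::metric_space measure"
  assumes X: "compact (UNIV :: 'a set)" and w: "weak_conv \<mu>s \<mu>"
    and \<mu>s: "\<And>n. sets (\<mu>s n) = sets borel" "\<And>n. prob_space (\<mu>s n)"
    and \<mu>: "sets \<mu> = sets borel" "prob_space \<mu>"
    and A: "A \<in> sets borel" "measure \<mu> (frontier A) = 0" and "e > 0"
  shows "eventually (\<lambda>n. measure (\<mu>s n) A < measure \<mu> A + e) sequentially"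
proof (cases "A = {}")
  case True then show ?thesis using \<open>e > 0\<close> by simp
next
  case False
  interpret prob_space \<mu> by fact
  define F where "F = closure A"
  have F: "closed F" "F \<noteq> {}" "A \<subseteq> F" using False closure_subset by (auto simp: F_def)
  have "measure \<mu> F \<le> measure \<mu> (A \<union> frontier A)"
    using A \<mu>(1) F interior_subset[of A] by (intro finite_measure_mono) (auto simp: F_def frontier_def)
  also have "\<dots> \<le> measure \<mu> A + measure \<mu> (frontier A)"
    using A \<mu>(1) by (intro measure_Un_le) auto
  finally have \<mu>F: "measure \<mu> F \<le> measure \<mu> A" using A by simp
  define g where "g j x = max 0 (1 - real j * infdist x F)" for j x
  have gc: "continuous_on UNIV (g j)" for j unfolding g_def by (intro continuous_intros)
  have "eventually (\<lambda>j. integral\<^sup>L \<mu> (g j) < measure \<mu> F + e) sequentially"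
    using order_tendstoD(2)[OF continuous_approx_closed[OF F(1,2) \<mu>], of "measure \<mu> F + e"] \<open>e > 0\<close>
    by (simp add: g_def[abs_def])
  then obtain j where "integral\<^sup>L \<mu> (g j) < measure \<mu> F + e"
    using eventually_happens'[OF sequentially_bot] by blast
  then have j: "integral\<^sup>L \<mu> (g j) < measure \<mu> A + e" using \<mu>F by linarith
  have "(\<lambda>n. integral\<^sup>L (\<mu>s n) (g j)) \<longlonglongrightarrow> integral\<^sup>L \<mu> (g j)"
    using w gc unfolding weak_conv_def by blast
  from order_tendstoD(2)[OF this j] show ?thesis
  proof eventually_elim
    case (elim n)
    interpret n: prob_space "\<mu>s n" by (rule \<mu>s)
    have [measurable]: "A \<in> sets (\<mu>s n)" using A \<mu>s by simp
    have "measure (\<mu>s n) A = (\<integral>x. indicator A x \<partial>\<mu>s n)" by simp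
    also have "\<dots> \<le> integral\<^sup>L (\<mu>s n) (g j)"
    proof (rule integral_mono)
      show "integrable (\<mu>s n) (g j)" by (rule integrable_continuous_compact_UNIV[OF X gc \<mu>s])
      show "indicator A x \<le> g j x" for x
        using F(3) by (auto simp: g_def indicator_def)
      show "integrable (\<mu>s n) (indicator A :: 'a \<Rightarrow> real)"
        by (intro n.integrable_const_bound[of _ 1]) auto
    qed
    finally show ?case using elim by simp
  qed
qed

lemma portmanteau:
  fixes \<mu> :: "'a::metric_space measure"
  assumes X: "compact (UNIV :: 'a set)" and w: "weak_conv \<mu>s \<mu>"
    and \<mu>s: "\<And>n. sets (\<mu>s n) = sets borel" "\<And>n. prob_space (\<mu>s n)"
    and \<mu>: "sets \<mu> = sets borel" "prob_space \<mu>"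
    and A: "A \<in> sets borel" "measure \<mu> (frontier A) = 0"
  shows "(\<lambda>n. measure (\<mu>s n) A) \<longlonglongrightarrow> measure \<mu> A"
proof (rule LIMSEQ_I)
  fix e :: real assume e: "e > 0"
  have comp: "measure M (- A) = 1 - measure M A" if "sets M = sets borel" "prob_space M" for M :: "'a measure"
    using prob_space.prob_compl[OF that(2), of A] A that sets_eq_imp_space_eq[OF that(1)] by (simp add: Compl_eq_Diff_UNIV)
  have "eventually (\<lambda>n. measure (\<mu>s n) A < measure \<mu> A + e) sequentially"
    by (rule portmanteau_upper[OF X w \<mu>s \<mu> A e])
  \<comment> \<open>The lower bound is the upper bound for the complement, which has the same
    frontier.\<close>
  moreover have "eventually (\<lambda>n. measure (\<mu>s n) (- A) < measure \<mu> (- A) + e) sequentially"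
    using A by (intro portmanteau_upper[OF X w \<mu>s \<mu> _ _ e]) (auto simp: frontier_complement)
  ultimately have "eventually (\<lambda>n. norm (measure (\<mu>s n) A - measure \<mu> A) < e) sequentially"
    by eventually_elim (auto simp: comp \<mu>s \<mu> abs_if)
  then show "\<exists>no. \<forall>n\<ge>no. norm (measure (\<mu>s n) A - measure \<mu> A) < e"
    by (simp add: eventually_sequentially)
qed

text \<open>Invariance is assumed asymptotically, so that the lemma serves both sequences of
  invariant measures and empirical measures of growing length.\<close>

lemma weak_limit_invariant:
  fixes f :: "'a::metric_space \<Rightarrow> 'a"
  assumes f: "continuous_on UNIV f" and w: "weak_conv \<mu>s \<mu>"
    and \<mu>: "sets \<mu> = sets borel" "prob_space \<mu>"
    and inv: "\<And>g :: 'a \<Rightarrow> real. continuous_on UNIV g \<Longrightarrow>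
      (\<lambda>n. (\<integral>x. g (f x) \<partial>\<mu>s n) - integral\<^sup>L (\<mu>s n) g) \<longlonglongrightarrow> 0"
  shows "\<mu> \<in> invariant_measures f"
proof -
  interpret prob_space \<mu> by fact
  have fm: "f \<in> measurable \<mu> borel"
    using borel_measurable_continuous_onI[OF f] measurable_cong_sets[OF \<mu>(1) refl] by blast
  have "distr \<mu> borel f = \<mu>"
  proof (rule prob_measure_eqI_continuous[OF _ prob_space_distr[OF fm] \<mu>])
    fix g :: "'a \<Rightarrow> real" assume g: "continuous_on UNIV g"
    have gf: "continuous_on UNIV (\<lambda>x. g (f x))"
      using continuous_on_compose2[OF g f] by simp
    have "(\<lambda>n. (\<integral>x. g (f x) \<partial>\<mu>s n) - integral\<^sup>L (\<mu>s n) g) \<longlonglongrightarrow> (\<integral>x. g (f x) \<partial>\<mu>) - integral\<^sup>L \<mu> g"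
      using w g gf unfolding weak_conv_def by (intro tendsto_diff) auto
    with inv[OF g] have "(\<integral>x. g (f x) \<partial>\<mu>) - integral\<^sup>L \<mu> g = 0" using LIMSEQ_unique by blast
    then show "integral\<^sup>L (distr \<mu> borel f) g = integral\<^sup>L \<mu> g"
      by (subst integral_distr[OF fm borel_measurable_continuous_onI[OF g]]) simp
  qed simp
  then have "emeasure \<mu> (f -` A) = emeasure \<mu> A" if "A \<in> sets borel" for A
    using emeasure_distr[OF fm that] sets_eq_imp_space_eq[OF \<mu>(1)] by simp
  then show ?thesis using \<mu> by (simp add: invariant_measures_def)
qed

lemma invariant_measures_compact:
  fixes f :: "'a::metric_space \<Rightarrow> 'a" and \<mu>s :: "nat \<Rightarrow> 'a measure"
  assumes X: "compact (UNIV :: 'a set)" and f: "continuous_on UNIV f"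
    and inv: "\<And>n. \<mu>s n \<in> invariant_measures f"
  obtains r \<mu> where "strict_mono r" "\<mu> \<in> invariant_measures f" "weak_conv (\<mu>s \<circ> r) \<mu>"
proof -
  obtain r \<mu> where r: "strict_mono r" "sets \<mu> = sets borel" "prob_space \<mu>" "weak_conv (\<mu>s \<circ> r) \<mu>"
    using compact_prob_space_weak_limit[OF X, of \<mu>s] invariant_measuresD[OF inv] by metis
  have "\<mu> \<in> invariant_measures f"
  proof (rule weak_limit_invariant[OF f r(4,2,3)])
    fix g :: "'a \<Rightarrow> real" assume g: "continuous_on UNIV g"
    have "(\<integral>x. g (f x) \<partial>\<mu>s n) = integral\<^sup>L (\<mu>s n) g" for n
    proof -
      note n = invariant_measuresD[OF inv[of n]]
      have fm: "f \<in> measurable (\<mu>s n) borel"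
        using borel_measurable_continuous_onI[OF f] measurable_cong_sets[OF n(1) refl] by blast
      have "distr (\<mu>s n) borel f = \<mu>s n"
      proof (rule measure_eqI)
        fix A assume "A \<in> sets (distr (\<mu>s n) borel f)"
        then have A: "A \<in> sets borel" by simp
        show "emeasure (distr (\<mu>s n) borel f) A = emeasure (\<mu>s n) A"
          using emeasure_distr[OF fm A] inv[of n] A n(2) by (simp add: invariant_measures_def)
      qed (simp add: n)
      then show ?thesis using integral_distr[OF fm borel_measurable_continuous_onI[OF g]] by simp
    qed
    then show "(\<lambda>n. (\<integral>x. g (f x) \<partial>(\<mu>s \<circ> r) n) - integral\<^sup>L ((\<mu>s \<circ> r) n) g) \<longlonglongrightarrow> 0" by simp
  qed
  with r show ?thesis by (intro that)
qed

section \<open>Measures from separated sets\<close>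

text \<open>The continuity sets of \<mu>, on which weak convergence gives convergence of measures.
  They form an algebra, so cells built from such sets are again of this kind.\<close>

definition null_frontier :: "'a::metric_space measure \<Rightarrow> 'a set \<Rightarrow> bool" where
  "null_frontier \<mu> A \<longleftrightarrow> A \<in> sets borel \<and> measure \<mu> (frontier A) = 0"

context
  fixes \<mu> :: "'a::metric_space measure"
  assumes \<mu>: "sets \<mu> = sets borel" "prob_space \<mu>"
begin

interpretation prob_space \<mu> by (rule \<mu>)

lemma null_subset:
  assumes "A \<subseteq> B" "A \<in> sets borel" "B \<in> sets borel" "measure \<mu> B = 0"
  shows "measure \<mu> A = 0"
  using finite_measure_mono[OF assms(1)] assms \<mu> measure_nonneg[of \<mu> A] by simp

lemma null_frontier_Compl: "null_frontier \<mu> A \<Longrightarrow> null_frontier \<mu> (- A)"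
  by (auto simp: null_frontier_def frontier_complement)

lemma null_frontier_Int:
  assumes "null_frontier \<mu> A" "null_frontier \<mu> B"
  shows "null_frontier \<mu> (A \<inter> B)"
proof -
  have "measure \<mu> (frontier A \<union> frontier B) \<le> measure \<mu> (frontier A) + measure \<mu> (frontier B)"
    using \<mu> by (intro measure_Un_le) auto
  then have "measure \<mu> (frontier A \<union> frontier B) = 0"
    using assms measure_nonneg[of \<mu> "frontier A \<union> frontier B"] unfolding null_frontier_def by linarith
  then have "measure \<mu> (frontier (A \<inter> B)) = 0"
    using frontier_Int_subset by (rule null_subset[rotated 3]) auto
  then show ?thesis using assms by (auto simp: null_frontier_def)
qed

lemma null_frontier_UNIV: "null_frontier \<mu> UNIV" and null_frontier_empty: "null_frontier \<mu> {}"
  by (auto simp: null_frontier_def)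

text \<open>Spheres about \<open>x\<close> with distinct radii are disjoint, so at most countably
  many have positive mass; their radii are the atoms of the law of \<open>dist x\<close>.\<close>

lemma null_frontier_ball:
  assumes "0 \<le> a" "a < b"
  obtains r where "a < r" "r < b" "null_frontier \<mu> (ball x r)"
proof -
  have m: "dist x \<in> borel_measurable \<mu>"
    unfolding measurable_cong_sets[OF \<mu>(1) refl]
    by (intro borel_measurable_continuous_onI continuous_intros)
  interpret D: prob_space "distr \<mu> borel (dist x)" by (rule prob_space_distr[OF m])
  obtain r where r: "r \<in> {a<..<b}" "measure (distr \<mu> borel (dist x)) {r} = 0"
    using open_minus_countable[OF D.countable_support, of "{a<..<b}"] assms by auto
  have sp: "space \<mu> = UNIV" using sets_eq_imp_space_eq[OF \<mu>(1)] by simp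
  have "measure \<mu> {y. dist x y = r} = 0"
    using r(2) by (subst (asm) measure_distr[OF m]) (auto simp: vimage_def sp)
  moreover have "frontier (ball x r) \<subseteq> {y. dist x y = r}"
  proof -
    have "closure (ball x r) \<subseteq> cball x r" by (intro closure_minimal) auto
    then show ?thesis by (auto simp: frontier_def interior_open)
  qed
  moreover have "{y. dist x y = r} \<in> sets borel"
    by (intro borel_closed closed_Collect_eq continuous_intros)
  ultimately have "null_frontier \<mu> (ball x r)"
    using null_subset by (auto simp: null_frontier_def)
  with r that show ?thesis by auto
qed

text \<open>A finite cover by balls of radius below \<open>e / 2\<close> with null frontiers is made
  disjoint: each point gets the index of the first ball containing it.\<close>

lemma null_frontier_labelling:
  assumes X: "compact (UNIV :: 'a set)" and "e > 0"
  obtains c :: "'a \<Rightarrow> nat" where "simple_function borel c" "\<And>l. null_frontier \<mu> (c -` {l})"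
    "\<And>x y. c x = c y \<Longrightarrow> dist x y < e"
proof -
  have "\<exists>r. 0 < r \<and> r < e / 2 \<and> null_frontier \<mu> (ball x r)" for x
    using null_frontier_ball[of 0 "e/2" x] \<open>e > 0\<close> by (metis half_gt_zero order_refl)
  then obtain r where r: "\<And>x. 0 < r x" "\<And>x. r x < e / 2" "\<And>x. null_frontier \<mu> (ball x (r x))" by metis
  have "UNIV \<subseteq> (\<Union>x. ball x (r x))" using r(1) centre_in_ball by blast
  then obtain T where T: "finite T" "UNIV \<subseteq> (\<Union>x\<in>T. ball x (r x))"
    using compactE_image[OF X, of UNIV "\<lambda>x. ball x (r x)"] by (metis open_ball)
  obtain xs where xs: "set xs = T" using finite_list[OF T(1)] by blast
  define B where "B i = ball (xs ! i) (r (xs ! i))" for i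
  have nB: "null_frontier \<mu> (B i)" for i by (simp add: B_def r)
  define c where "c x = (LEAST i. x \<in> B i)" for x
  have ex: "\<exists>i<length xs. x \<in> B i" for x
  proof -
    obtain t where t: "t \<in> T" "x \<in> ball t (r t)" using T(2) by blast
    then obtain i where "i < length xs" "xs ! i = t" using xs by (metis in_set_conv_nth)
    with t(2) show ?thesis by (auto simp: B_def)
  qed
  have cB: "x \<in> B (c x)" for x
    unfolding c_def using ex[of x] by (metis LeastI)
  have cl: "c x < length xs" for x
    unfolding c_def using ex[of x] Least_le[of "\<lambda>i. x \<in> B i"] by (metis le_less_trans)
  have cL: "x \<notin> B i" if "i < c x" for x i
    using not_less_Least[of i "\<lambda>i. x \<in> B i"] that unfolding c_def by blast
  have fibre: "c -` {l} = B l \<inter> (\<Inter>i<l. - B i)" for l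
  proof (intro equalityI subsetI)
    fix x assume "x \<in> c -` {l}"
    then show "x \<in> B l \<inter> (\<Inter>i<l. - B i)"
      using cB[of x] cL[of _ x] by auto
  next
    fix x assume x: "x \<in> B l \<inter> (\<Inter>i<l. - B i)"
    have "(LEAST i. x \<in> B i) = l"
    proof (rule Least_equality)
      show "l \<le> i" if "x \<in> B i" for i using x that by (meson ComplD INT_D IntD2 lessThan_iff not_le)
    qed (use x in blast)
    then show "x \<in> c -` {l}" by (simp add: c_def)
  qed
  have "null_frontier \<mu> (\<Inter>i<l. - B i)" for l
    by (induction l) (auto simp: lessThan_Suc null_frontier_UNIV intro!: null_frontier_Int null_frontier_Compl nB)
  then have nf: "null_frontier \<mu> (c -` {l})" for l
    unfolding fibre by (intro null_frontier_Int nB)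
  moreover have "simple_function borel c"
  proof -
    have "finite (range c)" by (rule finite_subset[of _ "{..<length xs}"]) (use cl in auto)
    moreover have "c -` {l} \<in> sets borel" for l using nf by (simp add: null_frontier_def)
    ultimately show ?thesis by (simp add: simple_function_def)
  qed
  moreover have "dist x y < e" if "c x = c y" for x y
    using cB[of x] cB[of y] r(2)[of "xs ! c x"] that dist_triangle_half_r[of "xs ! c x" x e y]
    by (simp add: B_def dist_commute)
  ultimately show ?thesis using that by blast
qed

end

lemma frontier_vimage_subset:
  assumes f: "continuous_on UNIV f"
  shows "frontier (f -` A) \<subseteq> f -` frontier A"
proof -
  have "closure (f -` A) \<subseteq> f -` closure A"
    using closure_subset[of A] by (intro closure_minimal closed_vimage f closed_closure) auto
  moreover have "f -` interior A \<subseteq> interior (f -` A)"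
    using interior_subset[of A] by (intro interior_maximal open_vimage f open_interior) auto
  ultimately show ?thesis by (auto simp: frontier_def)
qed

lemma null_frontier_vimage_funpow:
  assumes f: "continuous_on UNIV f" and \<mu>: "\<mu> \<in> invariant_measures f" and A: "null_frontier \<mu> A"
  shows "null_frontier \<mu> ((f ^^ n) -` A)"
proof -
  note fn = continuous_on_funpow[OF f, of n]
  have "measure \<mu> ((f ^^ n) -` frontier A) = 0"
    using measure_vimage_funpow[OF f \<mu>, of "frontier A" n] A by (simp add: null_frontier_def)
  moreover have "(f ^^ n) -` frontier A \<in> sets borel" by (rule vimage_funpow_borel[OF f]) simp
  ultimately have "measure \<mu> (frontier ((f ^^ n) -` A)) = 0"
    using frontier_vimage_subset[OF fn, of A]
    by (intro null_subset[OF invariant_measuresD(1,3)[OF \<mu>], of "frontier ((f ^^ n) -` A)" "(f ^^ n) -` frontier A"]) auto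
  then show ?thesis using A vimage_funpow_borel[OF f] by (simp add: null_frontier_def)
qed

text \<open>The cell of a word is a finite intersection of preimages of label cells; invariance of
  \<mu> keeps the frontiers of these preimages null.\<close>

lemma null_frontier_word:
  assumes f: "continuous_on UNIV f" and \<mu>: "\<mu> \<in> invariant_measures f"
    and c: "\<And>l. null_frontier \<mu> (c -` {l})"
  shows "null_frontier \<mu> (word f c n -` {w})"
proof (induction n arbitrary: w)
  note \<mu>' = invariant_measuresD[OF \<mu>]
  case 0
  have "word f c 0 -` {w} = (if w = [] then UNIV else {})" by auto
  then show ?case using null_frontier_UNIV[OF \<mu>'(1,3)] null_frontier_empty[OF \<mu>'(1,3)] by simp
next
  note \<mu>' = invariant_measuresD[OF \<mu>]
  case (Suc n)
  show ?case
  proof (cases w rule: rev_cases)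
    case Nil
    then have "word f c (Suc n) -` {w} = {}" by (auto simp: word_Suc)
    then show ?thesis using null_frontier_empty[OF \<mu>'(1,3)] by simp
  next
    case (snoc v l)
    then have "word f c (Suc n) -` {w} = word f c n -` {v} \<inter> (f ^^ n) -` (c -` {l})"
      by (auto simp: word_Suc)
    then show ?thesis
      using null_frontier_Int[OF \<mu>'(1,3) Suc null_frontier_vimage_funpow[OF f \<mu> c]] by metis
  qed
qed

text \<open>Serves the continuity of \<open>eta\<close> at 0, where the product rule for limits
  fails. It is \<open>ln y \<le> y - 1\<close> at \<open>y = 1 / sqrt x\<close>.\<close>

lemma eta_le_sqrt: "0 \<le> x \<Longrightarrow> eta x \<le> 2 * sqrt x"
proof (cases "x = 0")
  case False
  assume "0 \<le> x"
  with False have x: "x > 0" by simp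
  have "ln (1 / sqrt x) \<le> 1 / sqrt x - 1" using x by (intro ln_le_minus_one) simp
  then have "- ln x \<le> 2 * (1 / sqrt x)" using x by (simp add: ln_div ln_sqrt)
  then have "x * (- ln x) \<le> x * (2 * (1 / sqrt x))" using x by (intro mult_left_mono) auto
  also have "\<dots> = 2 * (x / sqrt x)" by simp
  also have "\<dots> = 2 * sqrt x" using x by (simp only: real_div_sqrt)
  finally show ?thesis by (simp add: eta_def)
qed simp

lemma tendsto_eta:
  assumes p: "p \<longlonglongrightarrow> q" and p01: "\<And>n. 0 \<le> p n" "\<And>n. p n \<le> 1"
  shows "(\<lambda>n. eta (p n)) \<longlonglongrightarrow> eta q"
proof (cases "q = 0")
  case True
  have "(\<lambda>n. 2 * sqrt (p n)) \<longlonglongrightarrow> 2 * sqrt q" by (intro tendsto_intros p)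
  then have "(\<lambda>n. eta (p n)) \<longlonglongrightarrow> 0"
    using True p01 eta_nonneg eta_le_sqrt
    by (intro tendsto_sandwich[of "\<lambda>_. 0" "\<lambda>n. eta (p n)" _ "\<lambda>n. 2 * sqrt (p n)"]) auto
  then show ?thesis using True by simp
next
  case False
  then show ?thesis unfolding eta_def by (intro tendsto_intros p)
qed

lemma label_entropy_tendsto:
  assumes X: "compact (UNIV :: 'a::metric_space set)" and w: "weak_conv \<mu>s (\<mu> :: 'a measure)"
    and \<mu>s: "\<And>n. sets (\<mu>s n) = sets borel" "\<And>n. prob_space (\<mu>s n)"
    and \<mu>: "sets \<mu> = sets borel" "prob_space \<mu>"
    and c: "finite (range c)" "\<And>l. null_frontier \<mu> (c -` {l})"
  shows "(\<lambda>n. label_entropy (\<mu>s n) c) \<longlonglongrightarrow> label_entropy \<mu> c"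
proof -
  have sp: "space \<mu> = UNIV" "space (\<mu>s n) = UNIV" for n
    using sets_eq_imp_space_eq[OF \<mu>(1)] sets_eq_imp_space_eq[OF \<mu>s(1)[of n]] by auto
  have "(\<lambda>n. eta (measure (\<mu>s n) (c -` {l}))) \<longlonglongrightarrow> eta (measure \<mu> (c -` {l}))" for l
    using c(2)[of l] prob_space.prob_le_1[OF \<mu>s(2)] unfolding null_frontier_def
    by (intro tendsto_eta portmanteau[OF X w \<mu>s \<mu>]) auto
  then show ?thesis unfolding label_entropy_def sp Int_UNIV_right by (intro tendsto_sum)
qed

section \<open>Empirical measures and Misiurewicz' argument\<close>

text \<open>The average of the orbit measures of length \<open>n\<close> over the points of
  \<open>E\<close>, encoded as the law of an iterate with uniform starting point and uniform time.
  As the image of a pmf it is a probability measure without conditions on \<open>E\<close> and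
  \<open>n\<close>.\<close>

definition empirical :: "('a::metric_space \<Rightarrow> 'a) \<Rightarrow> 'a set \<Rightarrow> nat \<Rightarrow> 'a measure" where
  "empirical f E n = distr (measure_pmf (pmf_of_set (E \<times> {..<n}))) borel (\<lambda>(x, i). (f ^^ i) x)"

lemma sets_empirical [simp]: "sets (empirical f E n) = sets borel"
  and space_empirical [simp]: "space (empirical f E n) = UNIV"
  and prob_space_empirical: "prob_space (empirical f E n)"
  unfolding empirical_def by (auto intro!: measure_pmf.prob_space_distr)

lemma integral_empirical:
  fixes g :: "'a::metric_space \<Rightarrow> real"
  assumes E: "finite E" "E \<noteq> {}" "n > 0" and g: "g \<in> borel_measurable borel"
  shows "integral\<^sup>L (empirical f E n) g = (\<Sum>x\<in>E. \<Sum>i<n. g ((f ^^ i) x)) / (real (card E) * real n)"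
proof -
  have "integral\<^sup>L (empirical f E n) g = measure_pmf.expectation (pmf_of_set (E \<times> {..<n})) (\<lambda>p. g ((f ^^ snd p) (fst p)))"
    unfolding empirical_def by (subst integral_distr[OF _ g]) (auto simp: case_prod_unfold)
  also have "\<dots> = (\<Sum>p\<in>E \<times> {..<n}. g ((f ^^ snd p) (fst p))) / real (card (E \<times> {..<n}))"
    using E by (intro integral_pmf_of_set) (auto simp: lessThan_empty_iff)
  finally show ?thesis by (simp add: sum.cartesian_product case_prod_unfold card_cartesian_product)
qed

text \<open>Separates the uniform time from the uniform starting point, the form to which concavity
  of label entropy applies.\<close>

lemma measure_empirical:
  assumes E: "finite E" "E \<noteq> {}" "n > 0" and A: "A \<in> sets borel"
  shows "measure (empirical f E n) A = (\<Sum>i<n. 1 / real n * measure (measure_pmf (pmf_of_set E)) ((f ^^ i) -` A))"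
proof -
  interpret prob_space "empirical f E n" by (rule prob_space_empirical)
  have "measure (empirical f E n) A = integral\<^sup>L (empirical f E n) (indicator A)"
    using A by simp
  also have "\<dots> = (\<Sum>x\<in>E. \<Sum>i<n. indicator A ((f ^^ i) x)) / (real (card E) * real n)"
    using A by (intro integral_empirical E) simp
  also have "\<dots> = (\<Sum>i<n. (\<Sum>x\<in>E. indicator A ((f ^^ i) x)) / (real (card E) * real n))"
    by (subst sum.swap) (simp add: sum_divide_distrib)
  also have "\<dots> = (\<Sum>i<n. 1 / real n * measure (measure_pmf (pmf_of_set E)) ((f ^^ i) -` A))"
  proof (intro sum.cong refl)
    fix i
    have "(\<Sum>x\<in>E. indicator A ((f ^^ i) x)) = (\<Sum>x\<in>E. indicator ((f ^^ i) -` A) x :: real)"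
      by (intro sum.cong) (auto simp: indicator_def)
    also have "\<dots> = real (card (E \<inter> (f ^^ i) -` A))" using E(1) by (simp add: indicator_def sum.If_cases Int_def)
    finally show "(\<Sum>x\<in>E. indicator A ((f ^^ i) x)) / (real (card E) * real n) =
        1 / real n * measure (measure_pmf (pmf_of_set E)) ((f ^^ i) -` A)"
      using E by (simp add: measure_pmf_of_set)
  qed
  finally show ?thesis .
qed

lemma label_entropy_uniform:
  assumes E: "finite E" "E \<noteq> {}" and c: "finite (range c)" "inj_on c E"
  shows "label_entropy (measure_pmf (pmf_of_set E)) c = ln (real (card E))"
proof -
  have m: "measure (measure_pmf (pmf_of_set E)) (c -` {l}) = (if l \<in> c ` E then 1 / real (card E) else 0)" for l
  proof (cases "l \<in> c ` E")
    case True
    then obtain x where x: "x \<in> E" "l = c x" by blast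
    then have "E \<inter> c -` {l} = {x}" using c(2) by (auto simp: inj_on_def)
    then show ?thesis using True E by (simp add: measure_pmf_of_set)
  next
    case False
    then have "E \<inter> c -` {l} = {}" by auto
    then show ?thesis using False E by (simp add: measure_pmf_of_set)
  qed
  have "label_entropy (measure_pmf (pmf_of_set E)) c = (\<Sum>l\<in>range c. if l \<in> c ` E then eta (1 / real (card E)) else 0)"
    unfolding label_entropy_def by (auto simp: m intro!: sum.cong)
  also have "\<dots> = (\<Sum>l\<in>c ` E. eta (1 / real (card E)))"
    using c(1) by (simp add: sum.If_cases) (metis Int_absorb1 image_mono subset_UNIV)
  also have "\<dots> = ln (real (card E))"
    using E c(2) by (simp add: card_image eta_def ln_div)
  finally show ?thesis .
qed

text \<open>\<open>G j k\<close> stands for the entropy of the word of length \<open>k\<close> read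
  from time \<open>j\<close>. For each offset \<open>j < m\<close> the stretch of length
  \<open>n\<close> is covered by a prefix of length \<open>j\<close>, then \<open>n div m\<close>
  blocks of length \<open>m\<close> and one more block. Over all offsets each start time occurs at
  most once, which produces the orbit sum; the \<open>2 * m\<close> boundary pieces, each costing at
  most \<open>m * L\<close>, give the error term.\<close>

lemma block_entropy_bound:
  fixes G :: "nat \<Rightarrow> nat \<Rightarrow> real"
  assumes sub: "\<And>j a b. G j (a + b) \<le> G j a + G (j + a) b"
    and mono: "\<And>j a b. G j a \<le> G j (a + b)"
    and bound: "\<And>j a. G j a \<le> real a * L" and nn: "\<And>j a. 0 \<le> G j a" and "L \<ge> 0" and m: "m > 0"
  shows "real m * G 0 n \<le> 2 * (real m)\<^sup>2 * L + (\<Sum>i<n. G i m)"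
proof -
  define q where "q = n div m"
  have blocks: "G j (k * m) \<le> (\<Sum>r<k. G (j + r * m) m)" for j k
  proof (induction k)
    case 0 then show ?case using bound[of j 0] by simp
  next
    case (Suc k)
    have "G j (Suc k * m) \<le> G j (k * m) + G (j + k * m) m"
      using sub[of j "k * m" m] by (simp add: add.commute)
    with Suc show ?case by simp
  qed
  have each: "G 0 n \<le> 2 * real m * L + (\<Sum>r<q. G (j + r * m) m)" if "j < m" for j
  proof -
    \<comment> \<open>The last block may overshoot \<open>n\<close>; monotonicity of
      \<open>G\<close> absorbs this.\<close>
    have "n \<le> j + (q * m + m)"
      using m div_mult_mod_eq[of n m] mod_less_divisor[OF m, of n] unfolding q_def by linarith
    then have "G 0 n \<le> G 0 (j + (q * m + m))"
      using mono[of 0 n "j + (q * m + m) - n"] by simp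
    also have "\<dots> \<le> G 0 j + (G j (q * m) + G (j + q * m) m)"
      using sub[of 0 j "q * m + m"] sub[of j "q * m" m] by simp
    also have "G 0 j \<le> real m * L"
      using bound[of 0 j] that \<open>L \<ge> 0\<close> by (smt (verit) mult_right_mono of_nat_less_iff)
    also have "G (j + q * m) m \<le> real m * L" by (rule bound)
    finally show ?thesis using blocks[of j q] by (simp add: algebra_simps)
  qed
  have "real m * G 0 n = (\<Sum>j<m. G 0 n)" by simp
  also have "\<dots> \<le> (\<Sum>j<m. 2 * real m * L + (\<Sum>r<q. G (j + r * m) m))"
    by (intro sum_mono each) auto
  also have "\<dots> = 2 * (real m)\<^sup>2 * L + (\<Sum>j<m. \<Sum>r<q. G (j + r * m) m)"
    by (simp add: sum.distrib power2_eq_square)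
  also have "(\<Sum>j<m. \<Sum>r<q. G (j + r * m) m) = (\<Sum>r<q. \<Sum>j<m. G (j + r * m) m)"
    by (rule sum.swap)
  \<comment> \<open>For fixed \<open>r\<close> the start times \<open>j + r * m\<close> with
    \<open>j < m\<close> fill one interval of length \<open>m\<close>; the intervals are adjacent
    and make up \<open>{..<q * m}\<close>.\<close>
  also have "\<dots> = (\<Sum>r<q. sum (\<lambda>i. G i m) {r * m..<r * m + m})"
  proof (rule sum.cong[OF refl])
    fix r show "(\<Sum>j<m. G (j + r * m) m) = sum (\<lambda>i. G i m) {r * m..<r * m + m}"
      using sum.shift_bounds_nat_ivl[of "\<lambda>i. G i m" 0 "r * m" m] by (simp add: atLeast0LessThan add.commute)
  qed
  also have "\<dots> = (\<Sum>i<q * m. G i m)" by (rule sum.nat_group)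
  also have "\<dots> \<le> (\<Sum>i<n. G i m)"
  proof (rule sum_mono2)
    show "{..<q * m} \<subseteq> {..<n}" by (auto simp: q_def intro: order_less_le_trans)
  qed (auto simp: nn)
  finally show ?thesis by simp
qed

text \<open>Injectivity makes the \<open>n\<close>-word entropy of the uniform distribution on
  \<open>E\<close> equal to \<open>ln (card E)\<close>. The block bound spreads it over
  \<open>m\<close>-words at all start times, and concavity bounds their average by the entropy of
  the empirical measure.\<close>

lemma misiurewicz_bound:
  fixes f :: "'a::metric_space \<Rightarrow> 'a"
  assumes f: "continuous_on UNIV f" and E: "finite E" "E \<noteq> {}"
    and c: "simple_function borel c" and inj: "inj_on (word f c n) E" and m: "m > 0" and n: "n > 0"
  shows "real m * ln (real (card E)) \<le> 2 * (real m)\<^sup>2 * ln (real (card (range c)))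
    + real n * label_entropy (empirical f E n) (word f c m)"
proof -
  let ?\<sigma> = "measure_pmf (pmf_of_set E)"
  have fin: "finite (range c)" using simple_functionD(1)[OF c] by simp
  have K: "card (range c) > 0" using fin by (simp add: card_gt_0_iff)
  define G where "G j k = label_entropy ?\<sigma> (\<lambda>x. word f c k ((f ^^ j) x))" for j k
  have sf: "simple_function ?\<sigma> d" if "finite (range d)" for d :: "'a \<Rightarrow> 'l"
    using that by (simp add: simple_function_def)
  have fc: "finite (range (\<lambda>x. c ((f ^^ i) x)))" for i
    by (rule finite_subset[OF _ fin]) auto
  have fw: "finite (range (\<lambda>x. word f c k ((f ^^ j) x)))" for j k
    by (rule finite_subset[OF _ finite_range_word[OF fin, of f k]]) auto
  have "real m * G 0 n \<le> 2 * (real m)\<^sup>2 * ln (real (card (range c))) + (\<Sum>i<n. G i m)"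
  proof (rule block_entropy_bound[OF _ _ _ _ _ m])
    fix j a b
    show "G j (a + b) \<le> G j a + G (j + a) b"
    proof -
      have "simple_function ?\<sigma> (\<lambda>x. c ((f ^^ i) ((f ^^ j) x)))" for i
        using sf[OF fc[of "i + j"]] by (simp add: funpow_add)
      from measure_pmf.label_entropy_word_add_le[of "pmf_of_set E" c f "f ^^ j", OF this, of a b]
      show ?thesis by (simp add: G_def funpow_add add.commute[of j a])
    qed
    show "G j a \<le> G j (a + b)"
    proof -
      have "word f c a x = take a (word f c (a + b) x)" for x
        by (simp add: word_add) (simp add: word_def)
      then show ?thesis
        unfolding G_def using measure_pmf.label_entropy_compose_le[OF sf[OF fw[of "a + b" j]], of "take a"] by simp
    qed
    show "G j a \<le> real a * ln (real (card (range c)))"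
    proof -
      have "G j a \<le> ln (real (card {w. set w \<subseteq> range c \<and> length w = a}))"
        unfolding G_def
        by (intro measure_pmf.label_entropy_le_card sf fw finite_lists_length_eq fin) (auto simp: word_def)
      also have "\<dots> = real a * ln (real (card (range c)))"
        using K by (simp add: card_lists_length_eq[OF fin] ln_realpow)
      finally show ?thesis .
    qed
    show "0 \<le> G j a" unfolding G_def by (rule measure_pmf.label_entropy_nonneg)
  qed (use K in simp)
  also have "G 0 n = ln (real (card E))"
    unfolding G_def using label_entropy_uniform[OF E finite_range_word[OF fin, of f n] inj] by simp
  also have "(\<Sum>i<n. G i m) \<le> real n * label_entropy (empirical f E n) (word f c m)"
  proof -
    have "(\<Sum>i<n. 1 / real n * label_entropy ?\<sigma> (\<lambda>x. word f c m ((f ^^ i) x))) \<le> label_entropy (empirical f E n) (word f c m)"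
    proof (rule label_entropy_concave[where S="range (word f c m)"])
      fix l
      have "word f c m -` {l} \<in> sets borel"
        using simple_functionD(2)[OF simple_function_word_borel[OF f c], of m "{l}"] by simp
      from measure_empirical[OF E n this, of f]
      show "measure (empirical f E n) (word f c m -` {l} \<inter> space (empirical f E n)) =
        (\<Sum>i<n. 1 / real n * measure ?\<sigma> ((\<lambda>x. word f c m ((f ^^ i) x)) -` {l} \<inter> space ?\<sigma>))"
        by (simp add: vimage_def)
    qed (use n finite_range_word[OF fin, of f m] in auto)
    then show ?thesis using n by (simp add: G_def field_simps flip: sum_divide_distrib)
  qed
  finally show ?thesis by simp
qed

lemma empirical_limit_invariant:
  fixes f :: "'a::metric_space \<Rightarrow> 'a"
  assumes X: "compact (UNIV :: 'a set)" and f: "continuous_on UNIV f"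
    and E: "\<And>k. finite (E k)" "\<And>k. E k \<noteq> {}" and N: "filterlim N at_top sequentially" "\<And>k. N k > 0"
    and \<mu>: "sets \<mu> = sets borel" "prob_space \<mu>" "weak_conv (\<lambda>k. empirical f (E k) (N k)) \<mu>"
  shows "\<mu> \<in> invariant_measures f"
proof (rule weak_limit_invariant[OF f \<mu>(3,1,2)])
  fix g :: "'a \<Rightarrow> real" assume g: "continuous_on UNIV g"
  obtain B where B: "B > 0" "\<And>x. \<bar>g x\<bar> \<le> B" using bounded_continuous_compact_UNIV[OF X g] by blast
  have gm: "g \<in> borel_measurable borel" by (rule borel_measurable_continuous_onI[OF g])
  have "continuous_on UNIV (\<lambda>x. g (f x))" using continuous_on_compose2[OF g f] by simp
  then have gfm: "(\<lambda>x. g (f x)) \<in> borel_measurable borel" by (rule borel_measurable_continuous_onI)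
  have bd: "norm ((\<integral>x. g (f x) \<partial>empirical f (E k) (N k)) - integral\<^sup>L (empirical f (E k) (N k)) g)
      \<le> 2 * B * (1 / real (N k))" for k
  proof -
    \<comment> \<open>Only the two ends of each orbit segment survive, so the defect of invariance
      is at most \<open>2 * B\<close> divided by the length.\<close>
    have tele: "(\<Sum>i<n. g (f ((f ^^ i) x)) - g ((f ^^ i) x)) = g ((f ^^ n) x) - g x" for n x
      by (induction n) auto
    have "(\<integral>x. g (f x) \<partial>empirical f (E k) (N k)) - integral\<^sup>L (empirical f (E k) (N k)) g
       = (\<Sum>x\<in>E k. (g ((f ^^ N k) x) - g x)) / (real (card (E k)) * real (N k))"
      by (simp add: integral_empirical[OF E(1,2) N(2) gm] integral_empirical[OF E(1,2) N(2) gfm]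
        diff_divide_distrib[symmetric] sum_subtractf[symmetric] tele)
    also have "norm \<dots> \<le> (\<Sum>x\<in>E k. 2 * B) / (real (card (E k)) * real (N k))"
    proof -
      have "\<bar>\<Sum>x\<in>E k. (g ((f ^^ N k) x) - g x)\<bar> \<le> (\<Sum>x\<in>E k. 2 * B)"
      proof (rule order_trans[OF sum_abs], rule sum_mono)
        fix x show "\<bar>g ((f ^^ N k) x) - g x\<bar> \<le> 2 * B" using B(2)[of x] B(2)[of "(f ^^ N k) x"] by linarith
      qed
      then have "\<bar>\<Sum>x\<in>E k. (g ((f ^^ N k) x) - g x)\<bar> / (real (card (E k)) * real (N k))
          \<le> (\<Sum>x\<in>E k. 2 * B) / (real (card (E k)) * real (N k))"
        by (intro divide_right_mono) auto
      then show ?thesis by (simp only: real_norm_def abs_divide abs_mult abs_of_nat)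
    qed
    also have "\<dots> = 2 * B * (1 / real (N k))" using E[of k] by simp
    finally show ?thesis .
  qed
  have "(\<lambda>k. 1 / real (N k)) \<longlonglongrightarrow> 0"
    using N(1) by (intro tendsto_divide_0[OF tendsto_const] filterlim_at_top_imp_at_infinity
      filterlim_compose[OF filterlim_real_sequentially])
  then have "(\<lambda>k. 2 * B * (1 / real (N k))) \<longlonglongrightarrow> 0" by (intro tendsto_mult_right_zero)
  then show "(\<lambda>k. (\<integral>x. g (f x) \<partial>empirical f (E k) (N k)) - integral\<^sup>L (empirical f (E k) (N k)) g) \<longlonglongrightarrow> 0"
    by (rule Lim_null_comparison[OF always_eventually, rotated]) (use bd in blast)
qed

text \<open>The labelling is chosen after the limit measure: its cells need \<mu>-null frontiers for
  label entropies to converge, and points with equal labels must be closer than \<open>e\<close> so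
  that separated points have distinct words. For fixed \<open>m\<close>, the constant
  \<open>b\<close> and the boundary term vanish after division by the length.\<close>

theorem misiurewicz:
  fixes f :: "'a::metric_space \<Rightarrow> 'a"
  assumes X: "compact (UNIV :: 'a set)" and f: "continuous_on UNIV f"
    and E: "\<And>k. finite (E k)" "\<And>k. E k \<noteq> {}" and N: "filterlim N at_top sequentially" "\<And>k. N k > 0"
    and sep: "\<And>k x y. x \<in> E k \<Longrightarrow> y \<in> E k \<Longrightarrow> x \<noteq> y \<Longrightarrow> \<exists>i<N k. dist ((f ^^ i) x) ((f ^^ i) y) \<ge> e"
    and e: "e > 0" and growth: "\<And>k. s * real (N k) + b \<le> ln (real (card (E k)))"
  obtains r \<mu> where "strict_mono r" "\<mu> \<in> invariant_measures f"
    "weak_conv (\<lambda>k. empirical f (E (r k)) (N (r k))) \<mu>" "ereal s \<le> metric_entropy f \<mu>"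
proof -
  obtain r \<mu> where r: "strict_mono r" and \<mu>: "sets \<mu> = sets borel" "prob_space \<mu>"
    and w: "weak_conv ((\<lambda>k. empirical f (E k) (N k)) \<circ> r) \<mu>"
    using compact_prob_space_weak_limit[OF X, of "\<lambda>k. empirical f (E k) (N k)"] prob_space_empirical
    by (metis sets_empirical)
  have w': "weak_conv (\<lambda>k. empirical f (E (r k)) (N (r k))) \<mu>" using w by (simp add: comp_def)
  have Nr: "filterlim (\<lambda>k. N (r k)) at_top sequentially"
    using filterlim_compose[OF N(1) filterlim_subseq[OF r]] .
  have inv: "\<mu> \<in> invariant_measures f"
    by (rule empirical_limit_invariant[OF X f E Nr N(2) \<mu> w'])
  obtain c :: "'a \<Rightarrow> nat" where c: "simple_function borel c" "\<And>l. null_frontier \<mu> (c -` {l})"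
    "\<And>x y. c x = c y \<Longrightarrow> dist x y < e"
    using null_frontier_labelling[OF \<mu> X e] by metis
  have fin: "finite (range c)" using simple_functionD(1)[OF c(1)] by simp
  have inj: "inj_on (word f c (N k)) (E k)" for k
  proof (rule inj_onI, rule ccontr)
    fix x y assume *: "x \<in> E k" "y \<in> E k" "word f c (N k) x = word f c (N k) y" "x \<noteq> y"
    then obtain i where "i < N k" "dist ((f ^^ i) x) ((f ^^ i) y) \<ge> e" using sep by blast
    moreover have "c ((f ^^ i) x) = c ((f ^^ i) y)" using *(3) \<open>i < N k\<close> by (simp add: word_eq_iff)
    ultimately show False using c(3) by fastforce
  qed
  have "ereal s \<le> metric_entropy f \<mu>"
  proof (rule metric_entropy_geI[OF f inv c(1)])
    fix m :: nat assume m: "m \<ge> 1"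
    define L where "L = 2 * (real m)\<^sup>2 * ln (real (card (range c)))"
    have le: "real m * s + real m * b * (1 / real (N (r k))) \<le>
        L * (1 / real (N (r k))) + label_entropy (empirical f (E (r k)) (N (r k))) (word f c m)" for k
    proof -
      let ?n = "N (r k)" and ?H = "label_entropy (empirical f (E (r k)) (N (r k))) (word f c m)"
      have "real m * (s * real ?n + b) \<le> real m * ln (real (card (E (r k))))"
        by (intro mult_left_mono growth) simp
      also have "\<dots> \<le> L + real ?n * ?H"
        unfolding L_def using m by (intro misiurewicz_bound f E c inj N) auto
      finally have "(real m * (s * real ?n + b)) / real ?n \<le> (L + real ?n * ?H) / real ?n"
        by (intro divide_right_mono) auto
      then show ?thesis using N(2)[of "r k"] by (simp add: field_simps)
    qed
    have n0: "(\<lambda>k. 1 / real (N (r k))) \<longlonglongrightarrow> 0"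
      using Nr by (intro tendsto_divide_0[OF tendsto_const] filterlim_at_top_imp_at_infinity
        filterlim_compose[OF filterlim_real_sequentially])
    have "(\<lambda>k. label_entropy (empirical f (E (r k)) (N (r k))) (word f c m)) \<longlonglongrightarrow> label_entropy \<mu> (word f c m)"
      by (intro label_entropy_tendsto[OF X w' _ _ \<mu>] finite_range_word fin null_frontier_word f inv c
        prob_space_empirical sets_empirical)
    then have "(\<lambda>k. L * (1 / real (N (r k))) + label_entropy (empirical f (E (r k)) (N (r k))) (word f c m))
       \<longlonglongrightarrow> L * 0 + label_entropy \<mu> (word f c m)"
      by (intro tendsto_intros n0)
    moreover have "(\<lambda>k. real m * s + real m * b * (1 / real (N (r k)))) \<longlonglongrightarrow> real m * s + real m * b * 0"
      by (intro tendsto_intros n0)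
    ultimately have "real m * s + real m * b * 0 \<le> L * 0 + label_entropy \<mu> (word f c m)"
      using le by (intro LIMSEQ_le) auto
    then show "s * real m \<le> label_entropy \<mu> (word f c m)" by (simp add: mult.commute)
  qed
  with r inv w' show ?thesis by (rule that)
qed

section \<open>Entropy of level sets\<close>

definition separated :: "('a::metric_space \<Rightarrow> 'a) \<Rightarrow> nat \<Rightarrow> real \<Rightarrow> 'a set \<Rightarrow> bool" where
  "separated f n e E \<longleftrightarrow> (\<forall>x\<in>E. \<forall>y\<in>E. x \<noteq> y \<longrightarrow> (\<exists>i<n. dist ((f ^^ i) x) ((f ^^ i) y) \<ge> e))"

text \<open>Points of a separated set have distinct words under a labelling finer than
  \<open>e\<close>, which bounds the cardinality. A separated set of maximal cardinality is
  spanning, as an uncovered point could be added.\<close>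

lemma maximal_separated:
  fixes f :: "'a::metric_space \<Rightarrow> 'a"
  assumes X: "compact (UNIV :: 'a set)" and "e > 0"
  obtains E where "finite E" "E \<subseteq> Y" "separated f n e E" "Y \<subseteq> (\<Union>x\<in>E. bowen_ball f x n e)"
proof -
  \<comment> \<open>An empirical measure serves as an arbitrary probability measure; what is wanted
    is a finite labelling finer than \<open>e\<close>.\<close>
  obtain c :: "'a \<Rightarrow> nat" where c: "simple_function borel c" "\<And>x y. c x = c y \<Longrightarrow> dist x y < e"
    using null_frontier_labelling[OF sets_empirical prob_space_empirical X \<open>e > 0\<close>] by metis
  have fin: "finite (range (word f c n))"
    using simple_functionD(1)[OF c(1)] by (intro finite_range_word) simp
  define P where "P E \<longleftrightarrow> finite E \<and> E \<subseteq> Y \<and> separated f n e E" for E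
  have inj: "inj_on (word f c n) E" if "separated f n e E" for E
  proof (rule inj_onI, rule ccontr)
    fix x y assume *: "x \<in> E" "y \<in> E" "word f c n x = word f c n y" "x \<noteq> y"
    then obtain i where i: "i < n" "dist ((f ^^ i) x) ((f ^^ i) y) \<ge> e"
      using \<open>separated f n e E\<close> unfolding separated_def by blast
    then have "c ((f ^^ i) x) = c ((f ^^ i) y)" using *(3) by (simp add: word_eq_iff)
    from c(2)[OF this] i(2) show False by simp
  qed
  have "card E < Suc (card (range (word f c n)))" if "P E" for E
  proof -
    have "card E = card (word f c n ` E)" using inj that by (simp add: P_def card_image)
    also have "\<dots> \<le> card (range (word f c n))" using fin by (intro card_mono) auto
    finally show ?thesis by simp
  qed
  moreover have "P {}" by (simp add: P_def separated_def)
  ultimately obtain E where E: "P E" and max: "\<And>F. P F \<Longrightarrow> card F \<le> card E"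
    using ex_has_greatest_nat[of P "{}" card "Suc (card (range (word f c n)))"] by blast
  have "y \<in> (\<Union>x\<in>E. bowen_ball f x n e)" if y: "y \<in> Y" for y
  proof (rule ccontr)
    assume not: "y \<notin> (\<Union>x\<in>E. bowen_ball f x n e)"
    then have far: "\<exists>i<n. dist ((f ^^ i) x) ((f ^^ i) y) \<ge> e" if "x \<in> E" for x
      using that unfolding bowen_ball_def by force
    have "y \<notin> E" using not \<open>e > 0\<close> by (auto simp: bowen_ball_def)
    have "separated f n e (insert y E)"
      using E far unfolding P_def separated_def by (metis dist_commute insert_iff)
    then have "P (insert y E)" using E y by (simp add: P_def)
    from max[OF this] show False using E \<open>y \<notin> E\<close> by (simp add: P_def)
  qed
  then show ?thesis using E that unfolding P_def by blast
qed

text \<open>Countable stability: \<open>Z K\<close> is covered at weight at most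
  \<open>\<eta> * (1/2)^Suc K\<close>, with one length per piece, and these weights sum to \<eta>.
  As lengths beyond any \<open>N\<close> are available, every \<open>bowen_M\<close> lies below
  every positive \<eta>.\<close>

lemma bowen_m_eq_0I:
  assumes Y: "Y \<subseteq> (\<Union>K. Z K)"
    and cover: "\<And>(K::nat) N \<eta>. \<eta> > 0 \<Longrightarrow> \<exists>E n. finite E \<and> n \<ge> N \<and> Z K \<subseteq> (\<Union>x\<in>E. bowen_ball f x n e)
      \<and> real (card E) * exp (- s * real n) \<le> \<eta>"
  shows "bowen_m f Y s e = 0"
proof -
  have "bowen_M f Y s e N \<le> ennreal \<eta>" if \<eta>: "\<eta> > 0" for N and \<eta> :: real
  proof -
    have "\<forall>K. \<exists>E n. finite E \<and> n \<ge> N \<and> Z K \<subseteq> (\<Union>x\<in>E. bowen_ball f x n e)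
      \<and> real (card E) * exp (- s * real n) \<le> \<eta> * (1/2)^Suc K"
      by (intro allI cover) (use \<eta> in simp)
    then obtain E n where E: "\<And>K. finite (E K)" "\<And>K. n K \<ge> N" "\<And>K. Z K \<subseteq> (\<Union>x\<in>E K. bowen_ball f x (n K) e)"
      "\<And>K. real (card (E K)) * exp (- s * real (n K)) \<le> \<eta> * (1/2)^Suc K" by metis
    define D where "D K = E K \<times> {n K}" for K
    define C where "C = (\<Union>K. D K)"
    let ?g = "\<lambda>p :: 'a \<times> nat. ennreal (exp (- s * real (snd p)))"
    have "countable (D K)" for K using E(1) by (intro countable_finite) (simp add: D_def)
    then have "countable C" unfolding C_def by simp
    moreover have "\<forall>p\<in>C. snd p \<ge> N" using E(2) by (auto simp: C_def D_def)
    moreover have "Y \<subseteq> (\<Union>p\<in>C. bowen_ball f (fst p) (snd p) e)"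
    proof
      fix y assume "y \<in> Y"
      then obtain K where "y \<in> Z K" using Y by blast
      then obtain x where "x \<in> E K" "y \<in> bowen_ball f x (n K) e" using E(3) by blast
      then show "y \<in> (\<Union>p\<in>C. bowen_ball f (fst p) (snd p) e)"
        by (intro UN_I[of "(x, n K)"]) (auto simp: C_def D_def)
    qed
    ultimately have "bowen_M f Y s e N \<le> nn_integral (count_space C) ?g"
      unfolding bowen_M_def by (intro INF_lower) auto
    also have "\<dots> = (\<integral>\<^sup>+p. ?g p * indicator C p \<partial>count_space UNIV)"
      by (rule nn_integral_count_space_indicator) (simp add: NO_MATCH_def)
    \<comment> \<open>A pair may belong to several \<open>D K\<close>, so the integral over the
      union is only bounded by the sum.\<close>
    also have "\<dots> \<le> (\<integral>\<^sup>+p. (\<Sum>K. ?g p * indicator (D K) p) \<partial>count_space UNIV)"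
    proof (rule nn_integral_mono)
      fix p
      show "?g p * indicator C p \<le> (\<Sum>K. ?g p * indicator (D K) p)"
      proof (cases "p \<in> C")
        case True
        then obtain K where K: "p \<in> D K" by (auto simp: C_def)
        have "(\<Sum>K\<in>{K}. ?g p * indicator (D K) p) \<le> (\<Sum>K. ?g p * indicator (D K) p)"
          by (rule sum_le_suminf) (auto intro: summableI)
        then show ?thesis using True K by simp
      qed simp
    qed
    also have "\<dots> = (\<Sum>K. \<integral>\<^sup>+p. ?g p * indicator (D K) p \<partial>count_space UNIV)"
      by (rule nn_integral_suminf) simp
    also have "\<dots> \<le> (\<Sum>K. ennreal (\<eta> * (1/2)^Suc K))"
    proof (intro suminf_le summableI)
      fix K
      have "(\<integral>\<^sup>+p. ?g p * indicator (D K) p \<partial>count_space UNIV) = nn_integral (count_space (D K)) ?g"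
        by (rule nn_integral_count_space_indicator[symmetric]) (simp add: NO_MATCH_def)
      also have "\<dots> = (\<Sum>p\<in>D K. ?g p)"
        using E(1) by (intro nn_integral_count_space_finite) (simp add: D_def)
      also have "\<dots> = (\<Sum>p\<in>D K. ennreal (exp (- s * real (n K))))"
        by (intro sum.cong) (auto simp: D_def)
      also have "\<dots> = ennreal (real (card (E K)) * exp (- s * real (n K)))"
        by (simp add: D_def card_cartesian_product ennreal_mult ennreal_of_nat_eq_real_of_nat)
      also have "\<dots> \<le> ennreal (\<eta> * (1/2)^Suc K)" by (intro ennreal_leI E)
      finally show "(\<integral>\<^sup>+p. ?g p * indicator (D K) p \<partial>count_space UNIV) \<le> ennreal (\<eta> * (1/2)^Suc K)" .
    qed
    also have "\<dots> = ennreal \<eta>"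
    proof (rule suminf_ennreal_eq)
      show "(\<lambda>K. \<eta> * (1/2)^Suc K) sums \<eta>" using sums_mult[OF power_half_series, of \<eta>] by simp
    qed (use \<eta> in simp)
    finally show ?thesis .
  qed
  then have "bowen_M f Y s e N = 0" for N
    using ennreal_le_epsilon[of 0 "bowen_M f Y s e N"] by simp
  then show ?thesis by (simp add: bowen_m_def)
qed

lemma htop_level_set_le:
  fixes f :: "'a::metric_space \<Rightarrow> 'a" and \<phi> :: "'a \<Rightarrow> real"
  assumes X: "compact (UNIV :: 'a set)" and f: "continuous_on UNIV f" and \<phi>: "continuous_on UNIV \<phi>"
    and "\<delta> > 0" "s \<ge> 0"
    and less: "\<And>\<mu>. \<mu> \<in> invariant_measures f \<Longrightarrow> \<bar>integral\<^sup>L \<mu> \<phi> - \<alpha>\<bar> \<le> \<delta> \<Longrightarrow> metric_entropy f \<mu> < ereal s"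
  shows "htop f (level_set f \<phi> \<alpha>) \<le> ereal s"
  unfolding htop_def
proof (rule SUP_least)
  fix e :: real assume "e \<in> {0<..}"
  then have e: "e > 0" by simp
  define S where "S n x = (\<Sum>k<n. \<phi> ((f ^^ k) x)) / real n" for n x
  \<comment> \<open>Birkhoff averages need not converge uniformly on the level set;
    \<open>Z K\<close> collects the points for which closeness holds from the common time
    \<open>K\<close>.\<close>
  define Z where "Z K = {x. \<forall>n\<ge>K. \<bar>S n x - \<alpha>\<bar> \<le> \<delta>}" for K :: nat
  have "level_set f \<phi> \<alpha> \<subseteq> (\<Union>K. Z K)"
  proof
    fix x assume "x \<in> level_set f \<phi> \<alpha>"
    then have "(\<lambda>n. S n x) \<longlonglongrightarrow> \<alpha>" by (simp add: level_set_def S_def)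
    then obtain K where "\<And>n. n \<ge> K \<Longrightarrow> \<bar>S n x - \<alpha>\<bar> < \<delta>"
      using LIMSEQ_D[OF _ \<open>\<delta> > 0\<close>] by (metis real_norm_def)
    then show "x \<in> (\<Union>K. Z K)" unfolding Z_def by (auto intro: less_imp_le)
  qed
  then have "bowen_m f (level_set f \<phi> \<alpha>) s e = 0"
  proof (rule bowen_m_eq_0I)
    fix K N :: nat and \<eta> :: real assume "\<eta> > 0"
    show "\<exists>E n. finite E \<and> n \<ge> N \<and> Z K \<subseteq> (\<Union>x\<in>E. bowen_ball f x n e) \<and> real (card E) * exp (- s * real n) \<le> \<eta>"
    proof (rule ccontr)
      assume neg: "\<not> ?thesis"
      \<comment> \<open>Lengths tending to infinity: at least \<open>N\<close>, where the cover is
        assumed to fail, at least \<open>K\<close>, where averages over \<open>Z K\<close> are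
        controlled, and positive.\<close>
      define n where "n k = N + K + k + 1" for k
      have "\<exists>E. finite E \<and> E \<subseteq> Z K \<and> separated f (n k) e E \<and> Z K \<subseteq> (\<Union>x\<in>E. bowen_ball f x (n k) e)" for k
        using maximal_separated[OF X e, of "Z K" f "n k"] by metis
      then obtain E where E: "\<And>k. finite (E k)" "\<And>k. E k \<subseteq> Z K" "\<And>k. separated f (n k) e (E k)"
        "\<And>k. Z K \<subseteq> (\<Union>x\<in>E k. bowen_ball f x (n k) e)" by metis
      have big: "real (card (E k)) * exp (- s * real (n k)) > \<eta>" for k
        using neg E(1,4)[of k] by (metis n_def le_add1 add.assoc not_le)
      have ne: "E k \<noteq> {}" for k using big[of k] \<open>\<eta> > 0\<close> by auto
      \<comment> \<open>Failure of the cover means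
        \<open>card (E k) > \<eta> * exp (s * n k)\<close>; the factor \<eta> becomes the additive
        constant \<open>ln \<eta>\<close> in the growth hypothesis of
        \<open>misiurewicz\<close>.\<close>
      have growth: "s * real (n k) + ln \<eta> \<le> ln (real (card (E k)))" for k
      proof -
        have "card (E k) > 0" using E(1) ne by (simp add: card_gt_0_iff)
        have "ln \<eta> \<le> ln (real (card (E k)) * exp (- s * real (n k)))"
          using big[of k] \<open>\<eta> > 0\<close> by simp
        also have "\<dots> = ln (real (card (E k))) - s * real (n k)"
          using \<open>card (E k) > 0\<close> by (simp add: ln_mult)
        finally show ?thesis by simp
      qed
      have npos: "n k > 0" for k by (simp add: n_def)
      have nlim: "filterlim n at_top sequentially"
        by (rule filterlim_at_top_mono[OF filterlim_ident]) (simp add: n_def)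
      obtain r \<mu> where r: "strict_mono r" and \<mu>: "\<mu> \<in> invariant_measures f" "ereal s \<le> metric_entropy f \<mu>"
        and w: "weak_conv (\<lambda>k. empirical f (E (r k)) (n (r k))) \<mu>"
      proof (rule misiurewicz[OF X f E(1) ne nlim npos _ e growth])
        show "\<exists>i<n k. e \<le> dist ((f ^^ i) x) ((f ^^ i) y)" if "x \<in> E k" "y \<in> E k" "x \<noteq> y" for k x y
          using E(3)[of k] that unfolding separated_def by blast
      qed (rule that)
      have "\<bar>integral\<^sup>L (empirical f (E k) (n k)) \<phi> - \<alpha>\<bar> \<le> \<delta>" for k
      proof -
        have c: "real (card (E k)) > 0" using E(1) ne by (simp add: card_gt_0_iff)
        have "integral\<^sup>L (empirical f (E k) (n k)) \<phi> = (\<Sum>x\<in>E k. S (n k) x) / real (card (E k))"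
          by (subst integral_empirical[OF E(1) ne npos borel_measurable_continuous_onI[OF \<phi>]])
            (simp add: S_def sum_divide_distrib mult.commute)
        also have "\<dots> - \<alpha> = (\<Sum>x\<in>E k. S (n k) x - \<alpha>) / real (card (E k))"
          using c by (simp add: sum_subtractf field_simps)
        also have "\<bar>\<dots>\<bar> \<le> (\<Sum>x\<in>E k. \<delta>) / real (card (E k))"
        proof -
          have "S (n k) x - \<alpha> \<le> \<delta> \<and> - (S (n k) x - \<alpha>) \<le> \<delta>" if "x \<in> E k" for x
          proof -
            have "x \<in> Z K" using that E(2) by blast
            moreover have "n k \<ge> K" by (simp add: n_def)
            ultimately have "\<bar>S (n k) x - \<alpha>\<bar> \<le> \<delta>" by (simp add: Z_def)
            then show ?thesis by linarith
          qed
          then have "\<bar>\<Sum>x\<in>E k. S (n k) x - \<alpha>\<bar> \<le> (\<Sum>x\<in>E k. \<delta>)"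
            by (intro order_trans[OF sum_abs] sum_mono) (simp add: abs_le_iff)
          then show ?thesis using c by (simp add: divide_right_mono del: sum_constant)
        qed
        also have "\<dots> = \<delta>" using c by simp
        finally show ?thesis .
      qed
      moreover have "(\<lambda>k. integral\<^sup>L (empirical f (E (r k)) (n (r k))) \<phi>) \<longlonglongrightarrow> integral\<^sup>L \<mu> \<phi>"
        using w \<phi> unfolding weak_conv_def by blast
      then have "(\<lambda>k. \<bar>integral\<^sup>L (empirical f (E (r k)) (n (r k))) \<phi> - \<alpha>\<bar>) \<longlonglongrightarrow> \<bar>integral\<^sup>L \<mu> \<phi> - \<alpha>\<bar>"
        by (intro tendsto_intros)
      ultimately have "\<bar>integral\<^sup>L \<mu> \<phi> - \<alpha>\<bar> \<le> \<delta>" by (intro LIMSEQ_le_const2) auto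
      from less[OF \<mu>(1) this] \<mu>(2) show False by simp
    qed
  qed
  then show "htop_eps f (level_set f \<phi> \<alpha>) e \<le> ereal s"
    unfolding htop_eps_def using \<open>s \<ge> 0\<close> by (intro Inf_lower) auto
qed

lemma htop_mono:
  assumes "A \<subseteq> B" shows "htop f A \<le> htop f B"
proof -
  have M: "bowen_M f A s e N \<le> bowen_M f B s e N" for s e N
    unfolding bowen_M_def using assms by (intro INF_superset_mono) auto
  have "bowen_m f A s e \<le> bowen_m f B s e" for s e
    unfolding bowen_m_def by (intro SUP_mono) (use M in blast)
  then have "htop_eps f A e \<le> htop_eps f B e" for e
    unfolding htop_eps_def by (intro Inf_superset_mono image_mono) (metis (lifting) Collect_mono le_zero_eq)
  then show ?thesis unfolding htop_def by (intro SUP_mono) blast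
qed

section \<open>Stability of the spectrum\<close>

text \<open>The generic points of \<mu> lie in the level set of its integral, and saturation makes
  them a nonempty set of full entropy.\<close>

lemma invariant_measure_level_set:
  fixes f :: "'a::metric_space \<Rightarrow> 'a"
  assumes H3: "saturated f" and \<mu>: "\<mu> \<in> invariant_measures f" and \<phi>: "continuous_on UNIV \<phi>"
  shows "integral\<^sup>L \<mu> \<phi> \<in> spectrum_R f \<phi>"
    "metric_entropy f \<mu> \<le> htop f (level_set f \<phi> (integral\<^sup>L \<mu> \<phi>))"
proof -
  have sub: "generic_points f \<mu> \<subseteq> level_set f \<phi> (integral\<^sup>L \<mu> \<phi>)"
    using \<phi> by (auto simp: generic_points_def level_set_def)
  have "generic_points f \<mu> \<noteq> {}" and h: "htop f (generic_points f \<mu>) = metric_entropy f \<mu>"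
    using H3 \<mu> by (auto simp: saturated_def)
  with sub show "integral\<^sup>L \<mu> \<phi> \<in> spectrum_R f \<phi>" by (auto simp: spectrum_R_def)
  show "metric_entropy f \<mu> \<le> htop f (level_set f \<phi> (integral\<^sup>L \<mu> \<phi>))"
    using htop_mono[OF sub, of f] h by simp
qed

text \<open>The \<phi>-integrals of the empirical measures of a single point are its Birkhoff
  averages, so any weak limit has integral \<alpha>. Together with saturation, the spectrum is
  exactly the set of integrals of invariant measures.\<close>

lemma spectrum_measure:
  fixes f :: "'a::metric_space \<Rightarrow> 'a" and \<phi> :: "'a \<Rightarrow> real"
  assumes X: "compact (UNIV :: 'a set)" and f: "continuous_on UNIV f" and \<phi>: "continuous_on UNIV \<phi>"
    and \<alpha>: "\<alpha> \<in> spectrum_R f \<phi>"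
  obtains \<mu> where "\<mu> \<in> invariant_measures f" "integral\<^sup>L \<mu> \<phi> = \<alpha>"
proof -
  obtain x where x: "x \<in> level_set f \<phi> \<alpha>" using \<alpha> by (auto simp: spectrum_R_def)
  obtain r \<mu> where r: "strict_mono r" "sets \<mu> = sets borel" "prob_space \<mu>"
    and w: "weak_conv ((\<lambda>k. empirical f {x} (Suc k)) \<circ> r) \<mu>"
    using compact_prob_space_weak_limit[OF X, of "\<lambda>k. empirical f {x} (Suc k)"] prob_space_empirical
    by (metis sets_empirical)
  have w': "weak_conv (\<lambda>k. empirical f {x} (Suc (r k))) \<mu>" using w by (simp add: comp_def)
  have lim: "filterlim (\<lambda>k. Suc (r k)) at_top sequentially"
    using filterlim_compose[OF filterlim_Suc filterlim_subseq[OF r(1)]] .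
  have "\<mu> \<in> invariant_measures f"
    by (rule empirical_limit_invariant[OF X f _ _ lim _ r(2,3) w']) auto
  moreover have "integral\<^sup>L \<mu> \<phi> = \<alpha>"
  proof (rule LIMSEQ_unique)
    show "(\<lambda>k. integral\<^sup>L (empirical f {x} (Suc (r k))) \<phi>) \<longlonglongrightarrow> integral\<^sup>L \<mu> \<phi>"
      using w' \<phi> unfolding weak_conv_def by blast
    have "(\<lambda>n. (\<Sum>k<n. \<phi> ((f ^^ k) x)) / real n) \<longlonglongrightarrow> \<alpha>" using x by (simp add: level_set_def)
    from filterlim_compose[OF this lim]
    show "(\<lambda>k. integral\<^sup>L (empirical f {x} (Suc (r k))) \<phi>) \<longlonglongrightarrow> \<alpha>"
      by (simp add: integral_empirical borel_measurable_continuous_onI[OF \<phi>]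
        of_nat_1[unfolded One_nat_def] del: sum.lessThan_Suc of_nat_Suc)
  qed
  ultimately show ?thesis by (rule that)
qed

definition usc_entropy :: "('a::metric_space \<Rightarrow> 'a) \<Rightarrow> bool" where
  "usc_entropy f \<longleftrightarrow> (\<forall>\<mu>s \<mu>. (\<forall>n. \<mu>s n \<in> invariant_measures f) \<longrightarrow> \<mu> \<in> invariant_measures f \<longrightarrow>
     weak_conv \<mu>s \<mu> \<longrightarrow> limsup (\<lambda>n. metric_entropy f (\<mu>s n)) \<le> metric_entropy f \<mu>)"

lemma usc_entropyD:
  assumes "usc_entropy f" "\<And>n. \<mu>s n \<in> invariant_measures f" "\<mu> \<in> invariant_measures f" "weak_conv \<mu>s \<mu>"
  shows "limsup (\<lambda>n. metric_entropy f (\<mu>s n)) \<le> metric_entropy f \<mu>"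
  by (rule assms(1)[unfolded usc_entropy_def, rule_format, OF assms(2-4)])

text \<open>Stated for real \<open>s\<close> strictly below the entropy of the level set, so that
  finite and infinite entropies are handled alike.\<close>

lemma spectrum_measure_entropy:
  fixes f :: "'a::metric_space \<Rightarrow> 'a" and \<phi> :: "'a \<Rightarrow> real"
  assumes X: "compact (UNIV :: 'a set)" and f: "continuous_on UNIV f" and \<phi>: "continuous_on UNIV \<phi>"
    and usc: "usc_entropy f"
    and \<alpha>: "\<alpha> \<in> spectrum_R f \<phi>" and s: "ereal s < htop f (level_set f \<phi> \<alpha>)"
  obtains \<mu> where "\<mu> \<in> invariant_measures f" "integral\<^sup>L \<mu> \<phi> = \<alpha>" "ereal s \<le> metric_entropy f \<mu>"
proof (cases "s < 0")
  \<comment> \<open>The level set estimate asks for \<open>s \<ge> 0\<close>; below that,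
    nonnegativity of entropy suffices.\<close>
  case True
  obtain \<mu> where \<mu>: "\<mu> \<in> invariant_measures f" "integral\<^sup>L \<mu> \<phi> = \<alpha>" by (rule spectrum_measure[OF X f \<phi> \<alpha>])
  have "ereal s \<le> 0" using True by (simp add: zero_ereal_def)
  also have "0 \<le> metric_entropy f \<mu>" by (rule metric_entropy_nonneg[OF f \<mu>(1)])
  finally show ?thesis using that \<mu> by blast
next
  case False
  have "\<exists>\<mu>. \<mu> \<in> invariant_measures f \<and> \<bar>integral\<^sup>L \<mu> \<phi> - \<alpha>\<bar> \<le> 1 / real (Suc k) \<and> ereal s \<le> metric_entropy f \<mu>" for k
  proof (rule ccontr)
    assume "\<not> ?thesis"
    then have "htop f (level_set f \<phi> \<alpha>) \<le> ereal s"
      using False by (intro htop_level_set_le[OF X f \<phi>, of "1 / real (Suc k)"]) (auto simp: not_le)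
    with s show False by simp
  qed
  then obtain \<mu>s where \<mu>s: "\<And>k. \<mu>s k \<in> invariant_measures f"
    "\<And>k. \<bar>integral\<^sup>L (\<mu>s k) \<phi> - \<alpha>\<bar> \<le> 1 / real (Suc k)" "\<And>k. ereal s \<le> metric_entropy f (\<mu>s k)" by metis
  obtain r \<mu> where r: "strict_mono r" and \<mu>: "\<mu> \<in> invariant_measures f" and w: "weak_conv (\<mu>s \<circ> r) \<mu>"
    by (rule invariant_measures_compact[OF X f \<mu>s(1)])
  have "(\<lambda>k. integral\<^sup>L (\<mu>s k) \<phi> - \<alpha>) \<longlonglongrightarrow> 0"
    using \<mu>s(2) by (intro Lim_null_comparison[OF always_eventually LIMSEQ_inverse_real_of_nat])
      (simp add: inverse_eq_divide)
  then have "(\<lambda>k. integral\<^sup>L (\<mu>s k) \<phi>) \<longlonglongrightarrow> \<alpha>" by (simp add: LIM_zero_iff)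
  from LIMSEQ_subseq_LIMSEQ[OF this r]
  have "integral\<^sup>L \<mu> \<phi> = \<alpha>"
    using w \<phi> unfolding weak_conv_def by (auto simp: comp_def intro: LIMSEQ_unique)
  moreover have "ereal s \<le> limsup (\<lambda>n. metric_entropy f ((\<mu>s \<circ> r) n))"
    using \<mu>s(3) by (intro le_Limsup) auto
  then have "ereal s \<le> metric_entropy f \<mu>"
    using usc_entropyD[OF usc, of "\<mu>s \<circ> r" \<mu>] \<mu>s(1) \<mu> w by (auto intro: order_trans)
  ultimately show ?thesis using that \<mu> by blast
qed

text \<open>Lower semicontinuity in one variable is automatic for a concave function, endpoints
  included: near the value at \<nu>, mix \<nu> with any measure lying on the relevant side.\<close>

lemma spectrum_lower_semicontinuous:
  fixes f :: "'a::metric_space \<Rightarrow> 'a" and \<phi> :: "'a \<Rightarrow> real"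
  assumes X: "compact (UNIV :: 'a set)" and f: "continuous_on UNIV f" and \<phi>: "continuous_on UNIV \<phi>"
    and \<nu>: "\<nu> \<in> invariant_measures f" "ereal h < metric_entropy f \<nu>" and "\<eta> > 0"
  obtains \<delta> where "\<delta> > 0" "\<And>\<rho>. \<rho> \<in> invariant_measures f \<Longrightarrow> \<bar>integral\<^sup>L \<rho> \<phi> - integral\<^sup>L \<nu> \<phi>\<bar> < \<delta> \<Longrightarrow>
    \<exists>\<rho>'\<in>invariant_measures f. integral\<^sup>L \<rho>' \<phi> = integral\<^sup>L \<rho> \<phi> \<and> ereal (h - \<eta>) \<le> metric_entropy f \<rho>'"
proof -
  define a where "a = integral\<^sup>L \<nu> \<phi>"
  define Q where "Q c \<longleftrightarrow> (\<exists>\<rho>'\<in>invariant_measures f. integral\<^sup>L \<rho>' \<phi> = c \<and> ereal (h - \<eta>) \<le> metric_entropy f \<rho>')" for c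
  \<comment> \<open>The largest admissible weight of the foreign measure: weight \<open>t\<close>
    replaces the entropy bound \<open>h\<close> by \<open>(1 - t) * h - t\<close>, a loss of
    \<open>t * (h + 1)\<close>, which is at most
    \<open>\<tau> * (\<bar>h\<bar> + 1) \<le> \<eta>\<close>.\<close>
  define \<tau> where "\<tau> = min 1 (\<eta> / (\<bar>h\<bar> + 1))"
  have \<tau>: "0 < \<tau>" "\<tau> \<le> 1" "\<tau> \<le> \<eta> / (\<bar>h\<bar> + 1)" using \<open>\<eta> > 0\<close> by (auto simp: \<tau>_def)
  then have \<tau>_le: "\<tau> * (\<bar>h\<bar> + 1) \<le> \<eta>" by (simp add: pos_le_divide_eq)
  have mix: "Q ((1 - t) * a + t * integral\<^sup>L \<rho> \<phi>)" if \<rho>: "\<rho> \<in> invariant_measures f" and t: "0 \<le> t" "t \<le> \<tau>" for \<rho> t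
  proof -
    have t1: "0 \<le> 1 - t" "1 - t \<le> 1" using t \<tau> by auto
    \<comment> \<open>The mixture lemma asks for a strict real lower bound; \<open>-1\<close> lies
      strictly below every nonnegative entropy.\<close>
    have h\<rho>: "ereal (-1) < metric_entropy f \<rho>"
      using metric_entropy_nonneg[OF f \<rho>] by (rule less_le_trans[rotated]) (simp add: zero_ereal_def)
    obtain \<rho>' where \<rho>': "\<rho>' \<in> invariant_measures f"
      "\<And>g :: 'a \<Rightarrow> real. continuous_on UNIV g \<Longrightarrow>
         integral\<^sup>L \<rho>' g = (1 - t) * integral\<^sup>L \<nu> g + (1 - (1 - t)) * integral\<^sup>L \<rho> g"
      "\<And>a b. ereal a < metric_entropy f \<nu> \<Longrightarrow> ereal b < metric_entropy f \<rho> \<Longrightarrow>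
         ereal ((1 - t) * a + (1 - (1 - t)) * b) \<le> metric_entropy f \<rho>'"
      by (rule invariant_mixture[OF X f \<nu>(1) \<rho> t1]) (rule that; blast)
    have "h - \<eta> \<le> (1 - t) * h + (1 - (1 - t)) * (-1)"
    proof -
      have "t * (h + 1) \<le> t * (\<bar>h\<bar> + 1)" using t by (intro mult_left_mono) auto
      also have "\<dots> \<le> \<tau> * (\<bar>h\<bar> + 1)" using t by (intro mult_right_mono) auto
      also have "\<dots> \<le> \<eta>" by (rule \<tau>_le)
      finally show ?thesis by (simp add: algebra_simps)
    qed
    then have "ereal (h - \<eta>) \<le> metric_entropy f \<rho>'"
      using \<rho>'(3)[OF \<nu>(2) h\<rho>] by (meson ereal_less_eq(3) order_trans)
    moreover have "integral\<^sup>L \<rho>' \<phi> = (1 - t) * a + t * integral\<^sup>L \<rho> \<phi>" using \<rho>'(2)[OF \<phi>] by (simp add: a_def)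
    ultimately show ?thesis unfolding Q_def using \<rho>'(1) by blast
  qed
  \<comment> \<open>The sign \<sigma> selects a side of \<open>a\<close>. If some measure has its
    integral \<open>b\<close> strictly on that side, mixing it in with weights up to \<tau> reaches
    every value at distance up to \<open>\<tau> * (\<sigma> * (b - a))\<close>.\<close>
  have side: "\<exists>\<delta>>0. \<forall>\<rho>\<in>invariant_measures f. 0 \<le> \<sigma> * (integral\<^sup>L \<rho> \<phi> - a) \<and> \<sigma> * (integral\<^sup>L \<rho> \<phi> - a) < \<delta> \<longrightarrow> Q (integral\<^sup>L \<rho> \<phi>)"
    if \<sigma>: "\<sigma> \<in> {1, -1}" for \<sigma> :: real
  proof (cases "\<exists>\<rho>\<in>invariant_measures f. 0 < \<sigma> * (integral\<^sup>L \<rho> \<phi> - a)")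
    case True
    then obtain \<rho>0 where \<rho>0: "\<rho>0 \<in> invariant_measures f" "0 < \<sigma> * (integral\<^sup>L \<rho>0 \<phi> - a)" by blast
    define b where "b = integral\<^sup>L \<rho>0 \<phi>"
    have b: "0 < \<sigma> * (b - a)" using \<rho>0 by (simp add: b_def)
    show ?thesis
    proof (intro exI[of _ "\<tau> * (\<sigma> * (b - a))"] conjI ballI impI)
      show "0 < \<tau> * (\<sigma> * (b - a))" using \<tau> b by simp
      fix \<rho> assume "\<rho> \<in> invariant_measures f"
        and c: "0 \<le> \<sigma> * (integral\<^sup>L \<rho> \<phi> - a) \<and> \<sigma> * (integral\<^sup>L \<rho> \<phi> - a) < \<tau> * (\<sigma> * (b - a))"
      define t where "t = (\<sigma> * (integral\<^sup>L \<rho> \<phi> - a)) / (\<sigma> * (b - a))"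
      have t: "0 \<le> t" "t \<le> \<tau>"
        unfolding t_def pos_divide_le_eq[OF b] using c
        by (blast intro: divide_nonneg_pos[OF _ b], blast intro: less_imp_le)
      have "t = (integral\<^sup>L \<rho> \<phi> - a) / (b - a)" and ba: "b - a \<noteq> 0" using \<sigma> b by (auto simp: t_def)
      then have "t * (b - a) = integral\<^sup>L \<rho> \<phi> - a" by simp
      then have "(1 - t) * a + t * b = integral\<^sup>L \<rho> \<phi>" by (simp add: algebra_simps)
      with mix[OF \<rho>0(1) t] show "Q (integral\<^sup>L \<rho> \<phi>)" by (simp add: b_def)
    qed
  next
    \<comment> \<open>Here \<open>a\<close> is an endpoint: only the value \<open>a\<close> itself
      has to be reached on this side, and any positive radius will do.\<close>
    case False
    have "Q a" using mix[OF \<nu>(1), of 0] \<tau> by simp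
    have "\<sigma> * (integral\<^sup>L \<rho> \<phi> - a) = 0 \<Longrightarrow> integral\<^sup>L \<rho> \<phi> = a" for \<rho> using \<sigma> by auto
    then show ?thesis using False \<open>Q a\<close> by (intro exI[of _ 1]) (metis less_eq_real_def zero_less_one)
  qed
  obtain \<delta>1 where \<delta>1: "\<delta>1 > 0" "\<And>\<rho>. \<rho> \<in> invariant_measures f \<Longrightarrow> 0 \<le> integral\<^sup>L \<rho> \<phi> - a \<Longrightarrow>
      integral\<^sup>L \<rho> \<phi> - a < \<delta>1 \<Longrightarrow> Q (integral\<^sup>L \<rho> \<phi>)"
    using side[of 1] by auto
  obtain \<delta>2 where \<delta>2: "\<delta>2 > 0" "\<And>\<rho>. \<rho> \<in> invariant_measures f \<Longrightarrow> 0 \<le> a - integral\<^sup>L \<rho> \<phi> \<Longrightarrow>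
      a - integral\<^sup>L \<rho> \<phi> < \<delta>2 \<Longrightarrow> Q (integral\<^sup>L \<rho> \<phi>)"
    using side[of "-1"] by auto
  show ?thesis
  proof (rule that[of "min \<delta>1 \<delta>2"])
    show "min \<delta>1 \<delta>2 > 0" using \<delta>1 \<delta>2 by simp
    fix \<rho> assume \<rho>: "\<rho> \<in> invariant_measures f" "\<bar>integral\<^sup>L \<rho> \<phi> - integral\<^sup>L \<nu> \<phi>\<bar> < min \<delta>1 \<delta>2"
    have "Q (integral\<^sup>L \<rho> \<phi>)"
    proof (cases "a \<le> integral\<^sup>L \<rho> \<phi>")
      case True
      then show ?thesis using \<rho> by (intro \<delta>1(2)) (auto simp: a_def)
    next
      case False
      then show ?thesis using \<rho> by (intro \<delta>2(2)) (auto simp: a_def)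
    qed
    then show "\<exists>\<rho>'\<in>invariant_measures f. integral\<^sup>L \<rho>' \<phi> = integral\<^sup>L \<rho> \<phi> \<and> ereal (h - \<eta>) \<le> metric_entropy f \<rho>'"
      by (simp add: Q_def)
  qed
qed

text \<open>The midpoint of \<mu> and \<nu> again has infinite entropy, since lower bounds for \<mu>
  survive with weight 1/2. It is then an equilibrium state of the zero potential, so it equals
  \<mu>, and comparing measures of sets gives \<nu> = \<mu>.\<close>

lemma infinite_entropy_unique:
  fixes f :: "'a::metric_space \<Rightarrow> 'a"
  assumes X: "compact (UNIV :: 'a set)" and f: "continuous_on UNIV f"
    and H2: "\<exists>!\<nu>. equilibrium_state f (\<lambda>_. 0) \<nu>"
    and \<mu>: "\<mu> \<in> invariant_measures f" "metric_entropy f \<mu> = \<infinity>" and \<nu>: "\<nu> \<in> invariant_measures f"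
  shows "\<nu> = \<mu>"
proof -
  have eqst: "equilibrium_state f (\<lambda>_. 0) \<rho>" if "\<rho> \<in> invariant_measures f" "metric_entropy f \<rho> = \<infinity>" for \<rho>
  proof -
    have "metric_entropy f \<rho> + ereal 0 \<le> (SUP \<mu>\<in>invariant_measures f. metric_entropy f \<mu> + ereal 0)"
      using that(1) by (intro SUP_upper)
    then show ?thesis using that by (simp add: equilibrium_state_def)
  qed
  have half: "0 \<le> (1/2 :: real)" "1/2 \<le> (1 :: real)" by auto
  obtain \<rho> where \<rho>: "\<rho> \<in> invariant_measures f"
    "\<And>A. A \<in> sets borel \<Longrightarrow> measure \<rho> A = (1/2) * measure \<mu> A + (1 - 1/2) * measure \<nu> A"
    "\<And>a b. ereal a < metric_entropy f \<mu> \<Longrightarrow> ereal b < metric_entropy f \<nu> \<Longrightarrow>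
       ereal ((1/2) * a + (1 - 1/2) * b) \<le> metric_entropy f \<rho>"
    by (rule invariant_mixture[OF X f \<mu>(1) \<nu> half]) (rule that; blast)
  have h\<nu>: "ereal (-1) < metric_entropy f \<nu>"
    using metric_entropy_nonneg[OF f \<nu>] by (rule less_le_trans[rotated]) (simp add: zero_ereal_def)
  \<comment> \<open>The bounds \<open>2 * B + 1\<close> and \<open>-1\<close> average to
    \<open>B\<close>.\<close>
  have "ereal B \<le> metric_entropy f \<rho>" for B
    using \<rho>(3)[of "2 * B + 1" "-1"] \<mu>(2) h\<nu> by (simp add: add_divide_distrib)
  then have "metric_entropy f \<rho> = \<infinity>" by (rule ereal_top)
  then have eq: "\<rho> = \<mu>" using H2 eqst \<rho>(1) \<mu> by blast
  show ?thesis
  proof (rule measure_eqI)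
    note \<mu>' = invariant_measuresD[OF \<mu>(1)] and \<nu>' = invariant_measuresD[OF \<nu>]
    interpret mu: prob_space \<mu> by (rule \<mu>')
    interpret nu: prob_space \<nu> by (rule \<nu>')
    show "sets \<nu> = sets \<mu>" using \<mu>' \<nu>' by simp
    fix A assume "A \<in> sets \<nu>"
    then have "measure \<nu> A = measure \<mu> A" using \<rho>(2)[of A] eq \<nu>' by simp
    then show "emeasure \<nu> A = emeasure \<mu> A" by (simp add: mu.emeasure_eq_measure nu.emeasure_eq_measure)
  qed
qed

lemma integral_diff_le:
  fixes \<phi> \<psi> :: "'a::metric_space \<Rightarrow> real"
  assumes X: "compact (UNIV :: 'a set)" and "continuous_on UNIV \<phi>" "continuous_on UNIV \<psi>"
    and d: "\<And>x. \<bar>\<phi> x - \<psi> x\<bar> \<le> d" and \<mu>: "sets \<mu> = sets borel" "prob_space \<mu>"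
  shows "\<bar>integral\<^sup>L \<mu> \<phi> - integral\<^sup>L \<mu> \<psi>\<bar> \<le> d"
proof -
  interpret prob_space \<mu> by fact
  have i: "integrable \<mu> \<phi>" "integrable \<mu> \<psi>"
    using assms by (auto intro!: integrable_continuous_compact_UNIV)
  have "\<bar>integral\<^sup>L \<mu> \<phi> - integral\<^sup>L \<mu> \<psi>\<bar> = \<bar>\<integral>x. \<phi> x - \<psi> x \<partial>\<mu>\<bar>" using i by simp
  also have "\<dots> \<le> (\<integral>x. \<bar>\<phi> x - \<psi> x\<bar> \<partial>\<mu>)" by (rule integral_abs_bound)
  also have "\<dots> \<le> (\<integral>x. d \<partial>\<mu>)"
    using i d by (intro integral_mono integrable_abs Bochner_Integration.integrable_diff) auto
  finally show ?thesis by (simp add: prob_space)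
qed

lemma spectrum_graph_close:
  fixes f :: "'a::metric_space \<Rightarrow> 'a" and \<phi> :: "'a \<Rightarrow> real"
  assumes X: "compact (UNIV :: 'a set)" and f: "continuous_on UNIV f"
    and usc: "usc_entropy f"
    and bounded: "\<And>\<mu>. \<mu> \<in> invariant_measures f \<Longrightarrow> metric_entropy f \<mu> \<le> ereal B"
    and H3: "saturated f" and \<phi>: "continuous_on UNIV \<phi>" and \<phi>s: "\<And>n. continuous_on UNIV (\<phi>s n)"
    and conv: "uniform_limit UNIV \<phi>s \<phi> sequentially" and e: "e > 0"
  shows "\<exists>N. \<forall>n\<ge>N. \<forall>\<alpha>\<in>spectrum_R f \<phi>. \<exists>\<beta>\<in>spectrum_R f (\<phi>s n). \<bar>\<beta> - \<alpha>\<bar> \<le> e \<and>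
    \<bar>real_of_ereal (htop f (level_set f (\<phi>s n) \<beta>)) - real_of_ereal (htop f (level_set f \<phi> \<alpha>))\<bar> \<le> e"
proof (rule ccontr)
  assume neg: "\<not> ?thesis"
  define E where "E \<psi> \<alpha> = real_of_ereal (htop f (level_set f \<psi> \<alpha>))" for \<psi> \<alpha>
  \<comment> \<open>Here the real heights are faithful: the bound \<open>B\<close> and saturation
    keep level set entropies between 0 and \<open>B\<close>, so \<open>real_of_ereal\<close> loses
    nothing.\<close>
  have E: "htop f (level_set f \<psi> \<alpha>) = ereal (E \<psi> \<alpha>)"
    if \<psi>: "continuous_on UNIV \<psi>" and \<alpha>: "\<alpha> \<in> spectrum_R f \<psi>" for \<psi> \<alpha>
  proof -
    have "htop f (level_set f \<psi> \<alpha>) \<le> ereal B"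
    proof (rule ccontr)
      assume "\<not> ?thesis"
      then obtain s where s: "ereal B < ereal s" "ereal s < htop f (level_set f \<psi> \<alpha>)"
        using ereal_dense2 by (metis not_le)
      obtain \<mu> where "\<mu> \<in> invariant_measures f" "ereal s \<le> metric_entropy f \<mu>"
        using spectrum_measure_entropy[OF X f \<psi> usc \<alpha> s(2)] by metis
      with bounded[of \<mu>] s(1) show False by (meson leD order_trans)
    qed
    moreover have "0 \<le> htop f (level_set f \<psi> \<alpha>)"
    proof -
      obtain \<mu> where \<mu>: "\<mu> \<in> invariant_measures f" "integral\<^sup>L \<mu> \<psi> = \<alpha>" by (rule spectrum_measure[OF X f \<psi> \<alpha>])
      have "0 \<le> metric_entropy f \<mu>" by (rule metric_entropy_nonneg[OF f \<mu>(1)])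
      also have "\<dots> \<le> htop f (level_set f \<psi> \<alpha>)" using invariant_measure_level_set(2)[OF H3 \<mu>(1) \<psi>] \<mu>(2) by simp
      finally show ?thesis .
    qed
    ultimately show ?thesis
      unfolding E_def by (cases "htop f (level_set f \<psi> \<alpha>)") auto
  qed
  have lower: "metric_entropy f \<mu> \<le> ereal (E \<psi> (integral\<^sup>L \<mu> \<psi>))"
    if "\<mu> \<in> invariant_measures f" "continuous_on UNIV \<psi>" for \<mu> \<psi>
    using invariant_measure_level_set[OF H3 that] E[OF that(2)] by simp
  have upper: "\<exists>\<mu>\<in>invariant_measures f. integral\<^sup>L \<mu> \<psi> = \<alpha> \<and> ereal s \<le> metric_entropy f \<mu>"
    if "continuous_on UNIV \<psi>" "\<alpha> \<in> spectrum_R f \<psi>" "s < E \<psi> \<alpha>" for \<psi> \<alpha> s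
    using spectrum_measure_entropy[OF X f that(1) usc that(2), of s] E[OF that(1,2)] that(3) by (metis ereal_less_le less_ereal.simps(1))
  have unif: "\<exists>N. \<forall>n\<ge>N. \<forall>x. \<bar>\<phi>s n x - \<phi> x\<bar> \<le> d" if "d > 0" for d
    using uniform_limitD[OF conv that] unfolding eventually_sequentially dist_real_def
    by (meson UNIV_I less_imp_le)
  obtain N0 where N0: "\<And>n x. n \<ge> N0 \<Longrightarrow> \<bar>\<phi>s n x - \<phi> x\<bar> \<le> e" using unif[OF e] by blast
  have "\<exists>n \<alpha>. n \<ge> max k N0 \<and> \<alpha> \<in> spectrum_R f \<phi> \<and>
    (\<forall>\<beta>\<in>spectrum_R f (\<phi>s n). \<bar>\<beta> - \<alpha>\<bar> \<le> e \<longrightarrow> \<bar>E (\<phi>s n) \<beta> - E \<phi> \<alpha>\<bar> > e)" for k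
    using neg unfolding E_def by (metis not_le)
  then obtain n \<alpha> where n: "\<And>k. n k \<ge> k" "\<And>k. n k \<ge> N0" and \<alpha>: "\<And>k. \<alpha> k \<in> spectrum_R f \<phi>"
    and bad: "\<And>k \<beta>. \<beta> \<in> spectrum_R f (\<phi>s (n k)) \<Longrightarrow> \<bar>\<beta> - \<alpha> k\<bar> \<le> e \<Longrightarrow> \<bar>E (\<phi>s (n k)) \<beta> - E \<phi> (\<alpha> k)\<bar> > e"
    by (metis max.bounded_iff)
  have "\<exists>\<mu>\<in>invariant_measures f. integral\<^sup>L \<mu> \<phi> = \<alpha> k \<and> ereal (E \<phi> (\<alpha> k) - e/2) \<le> metric_entropy f \<mu>" for k
    using upper[OF \<phi> \<alpha>] e by simp
  then obtain \<mu> where \<mu>: "\<And>k. \<mu> k \<in> invariant_measures f" "\<And>k. integral\<^sup>L (\<mu> k) \<phi> = \<alpha> k"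
    "\<And>k. ereal (E \<phi> (\<alpha> k) - e/2) \<le> metric_entropy f (\<mu> k)" by metis
  define \<beta> where "\<beta> k = integral\<^sup>L (\<mu> k) (\<phi>s (n k))" for k
  have \<beta>: "\<beta> k \<in> spectrum_R f (\<phi>s (n k))" for k
    unfolding \<beta>_def by (rule invariant_measure_level_set[OF H3 \<mu>(1) \<phi>s])
  have diff: "\<bar>integral\<^sup>L \<rho> (\<phi>s m) - integral\<^sup>L \<rho> \<phi>\<bar> \<le> d"
    if "\<rho> \<in> invariant_measures f" "\<forall>x. \<bar>\<phi>s m x - \<phi> x\<bar> \<le> d" for \<rho> m d
    using that invariant_measuresD[OF that(1)] by (intro integral_diff_le[OF X \<phi>s \<phi>]) auto
  \<comment> \<open>A difference above \<open>e\<close> could have either sign. The perturbed height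
    cannot fall short by that much, because \<open>\<mu> k\<close> already secures all but
    \<open>e / 2\<close>; so it overshoots.\<close>
  have jump: "E \<phi> (\<alpha> k) + e < E (\<phi>s (n k)) (\<beta> k)" for k
  proof -
    have "\<bar>\<beta> k - \<alpha> k\<bar> \<le> e" unfolding \<beta>_def \<mu>(2)[symmetric] using N0 n by (intro diff \<mu>) auto
    from bad[OF \<beta> this] have "\<bar>E (\<phi>s (n k)) (\<beta> k) - E \<phi> (\<alpha> k)\<bar> > e" .
    moreover have "ereal (E \<phi> (\<alpha> k) - e/2) \<le> ereal (E (\<phi>s (n k)) (\<beta> k))"
      unfolding \<beta>_def using \<mu>(3) lower[OF \<mu>(1) \<phi>s] by (rule order_trans)
    then have "E \<phi> (\<alpha> k) - e/2 \<le> E (\<phi>s (n k)) (\<beta> k)" by simp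
    ultimately show ?thesis using e by linarith
  qed
  have "\<exists>\<nu>\<in>invariant_measures f. integral\<^sup>L \<nu> (\<phi>s (n k)) = \<beta> k \<and> ereal (E \<phi> (\<alpha> k) + e) \<le> metric_entropy f \<nu>" for k
    by (rule upper[OF \<phi>s \<beta> jump])
  then obtain \<nu> where \<nu>: "\<And>k. \<nu> k \<in> invariant_measures f" "\<And>k. integral\<^sup>L (\<nu> k) (\<phi>s (n k)) = \<beta> k"
    "\<And>k. ereal (E \<phi> (\<alpha> k) + e) \<le> metric_entropy f (\<nu> k)" by metis
  obtain r \<nu>' where r: "strict_mono r" and \<nu>': "\<nu>' \<in> invariant_measures f" and w: "weak_conv (\<nu> \<circ> r) \<nu>'"
    by (rule invariant_measures_compact[OF X f \<nu>(1)])
  \<comment> \<open>\<open>\<mu> k\<close> and \<open>\<nu> k\<close> give the perturbed potential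
    the same integral \<open>\<beta> k\<close>; exchanging the potential once for each costs
    \<open>2 * d / 3\<close> in total.\<close>
  have "(\<lambda>k. \<alpha> k - integral\<^sup>L (\<nu> k) \<phi>) \<longlonglongrightarrow> 0"
  proof (rule LIMSEQ_I)
    fix d :: real assume "d > 0"
    then obtain N where N: "\<And>n. n \<ge> N \<Longrightarrow> \<forall>x. \<bar>\<phi>s n x - \<phi> x\<bar> \<le> d/3" using unif[of "d/3"] by auto
    have "\<bar>\<alpha> k - integral\<^sup>L (\<nu> k) \<phi>\<bar> < d" if "k \<ge> N" for k
    proof -
      have "n k \<ge> N" using n(1)[of k] that by simp
      then have "\<bar>\<beta> k - \<alpha> k\<bar> \<le> d/3" "\<bar>\<beta> k - integral\<^sup>L (\<nu> k) \<phi>\<bar> \<le> d/3"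
        using diff[OF \<mu>(1) N, of "n k" k] diff[OF \<nu>(1) N, of "n k" k] by (simp_all add: \<nu>(2) \<mu>(2) \<beta>_def)
      then show ?thesis using \<open>d > 0\<close> by linarith
    qed
    then show "\<exists>no. \<forall>k\<ge>no. norm (\<alpha> k - integral\<^sup>L (\<nu> k) \<phi> - 0) < d" by auto
  qed
  from LIMSEQ_subseq_LIMSEQ[OF this r]
  have "(\<lambda>k. \<alpha> (r k) - integral\<^sup>L (\<nu> (r k)) \<phi>) \<longlonglongrightarrow> 0" by (simp add: comp_def)
  moreover have "(\<lambda>k. integral\<^sup>L (\<nu> (r k)) \<phi>) \<longlonglongrightarrow> integral\<^sup>L \<nu>' \<phi>"
    using w \<phi> unfolding weak_conv_def by simp
  ultimately have lim: "(\<lambda>k. \<alpha> (r k)) \<longlonglongrightarrow> integral\<^sup>L \<nu>' \<phi>"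
    using tendsto_add by fastforce
  obtain h where h: "metric_entropy f \<nu>' = ereal h"
    using metric_entropy_nonneg[OF f \<nu>'] bounded[OF \<nu>'] by (cases "metric_entropy f \<nu>'") auto
  \<comment> \<open>Budget: the jump \<open>e\<close>, minus \<open>e / 4\<close> for a strict bound
    below \<open>h\<close> and \<open>e / 4\<close> for lower semicontinuity, leaves entropies of at
    least \<open>h + e / 2\<close>, more than upper semicontinuity permits in the limit.\<close>
  have "ereal (h - e/4) < metric_entropy f \<nu>'" using e by (simp add: h)
  from spectrum_lower_semicontinuous[OF X f \<phi> \<nu>' this, of "e/4"] e
  obtain \<delta> where \<delta>: "\<delta> > 0" "\<And>\<rho>. \<rho> \<in> invariant_measures f \<Longrightarrow> \<bar>integral\<^sup>L \<rho> \<phi> - integral\<^sup>L \<nu>' \<phi>\<bar> < \<delta> \<Longrightarrow>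
    \<exists>\<rho>'\<in>invariant_measures f. integral\<^sup>L \<rho>' \<phi> = integral\<^sup>L \<rho> \<phi> \<and> ereal (h - e/4 - e/4) \<le> metric_entropy f \<rho>'"
    by auto
  obtain M where M: "\<And>k. k \<ge> M \<Longrightarrow> \<bar>\<alpha> (r k) - integral\<^sup>L \<nu>' \<phi>\<bar> < \<delta>"
    using LIMSEQ_D[OF lim \<delta>(1)] by auto
  have "ereal (h + e/2) \<le> metric_entropy f ((\<nu> \<circ> r) k)" if k: "k \<ge> M" for k
  proof -
    obtain \<rho>' where \<rho>': "\<rho>' \<in> invariant_measures f" "integral\<^sup>L \<rho>' \<phi> = \<alpha> (r k)" "ereal (h - e/4 - e/4) \<le> metric_entropy f \<rho>'"
      using \<delta>(2)[OF \<mu>(1), of "r k"] M[OF k] by (auto simp: \<mu>(2))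
    have "ereal (h - e/4 - e/4) \<le> ereal (E \<phi> (\<alpha> (r k)))"
      using lower[OF \<rho>'(1) \<phi>] \<rho>'(2,3) by (metis order_trans)
    then have "ereal (h + e/2) \<le> ereal (E \<phi> (\<alpha> (r k)) + e)" by simp
    also have "\<dots> \<le> metric_entropy f (\<nu> (r k))" by (rule \<nu>)
    finally show ?thesis by simp
  qed
  then have "ereal (h + e/2) \<le> limsup (\<lambda>k. metric_entropy f ((\<nu> \<circ> r) k))"
    by (intro le_Limsup) (auto simp: eventually_sequentially)
  also have "\<dots> \<le> ereal h" using usc_entropyD[OF usc, of "\<nu> \<circ> r" \<nu>'] \<nu>(1) \<nu>' w h by auto
  finally show False using e by simp
qed

theorem theoremC:
  fixes f :: "'a::metric_space \<Rightarrow> 'a"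
  assumes X_compact: "compact (UNIV :: 'a set)"
    and f_cont: "continuous_on UNIV f"
    and H1: "\<And>\<mu>s \<mu>. (\<forall>n. \<mu>s n \<in> invariant_measures f) \<Longrightarrow> \<mu> \<in> invariant_measures f \<Longrightarrow>
               weak_conv \<mu>s \<mu> \<Longrightarrow>
               limsup (\<lambda>n. metric_entropy f (\<mu>s n)) \<le> metric_entropy f \<mu>"
    and H2: "\<And>\<psi> C. C-lipschitz_on UNIV \<psi> \<Longrightarrow> \<exists>!\<nu>. equilibrium_state f \<psi> \<nu>"
    and H3: "saturated f"
    and phi_cont: "continuous_on UNIV \<phi>"
    and phis_cont: "\<And>n. continuous_on UNIV (\<phi>s n)"
    and conv: "uniform_limit UNIV \<phi>s \<phi> sequentially"
  shows "(\<lambda>n. SUP q\<in>entropy_graph f \<phi>. infdist q (entropy_graph f (\<phi>s n))) \<longlonglongrightarrow> 0"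
proof -
  have usc: "usc_entropy f" using H1 unfolding usc_entropy_def by blast
  have H2': "\<exists>!\<nu>. equilibrium_state f (\<lambda>_. 0) \<nu>"
    by (rule H2[of 0]) (simp add: lipschitz_on_def)
  then obtain \<nu> where "equilibrium_state f (\<lambda>_. 0) \<nu>" by blast
  then have \<nu>: "\<nu> \<in> invariant_measures f" and max: "\<And>\<mu>. \<mu> \<in> invariant_measures f \<Longrightarrow> metric_entropy f \<mu> \<le> metric_entropy f \<nu>"
    by (auto simp: equilibrium_state_def intro: SUP_upper)
  have close: "\<exists>N. \<forall>n\<ge>N. \<forall>\<alpha>\<in>spectrum_R f \<phi>. \<exists>\<beta>\<in>spectrum_R f (\<phi>s n). \<bar>\<beta> - \<alpha>\<bar> \<le> e \<and>
    \<bar>real_of_ereal (htop f (level_set f (\<phi>s n) \<beta>)) - real_of_ereal (htop f (level_set f \<phi> \<alpha>))\<bar> \<le> e"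
    if e: "e > 0" for e
  proof (cases "metric_entropy f \<nu> = \<infinity>")
    case False
    then obtain B where "metric_entropy f \<nu> = ereal B"
      using metric_entropy_nonneg[OF f_cont \<nu>] by (cases "metric_entropy f \<nu>") auto
    then show ?thesis
      using max by (intro spectrum_graph_close[OF X_compact f_cont usc _ H3 phi_cont phis_cont conv e]) auto
  next
    case True
    note only = infinite_entropy_unique[OF X_compact f_cont H2' \<nu> True]
    \<comment> \<open>The level set has infinite entropy, which \<open>real_of_ereal\<close> maps to
      0: the graphs are single points at height 0, and only the abscissae differ.\<close>
    have E0: "real_of_ereal (htop f (level_set f \<psi> (integral\<^sup>L \<nu> \<psi>))) = 0" if "continuous_on UNIV \<psi>" for \<psi>
      using invariant_measure_level_set(2)[OF H3 \<nu> that] True by simp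
    obtain N where N: "\<And>n x. n \<ge> N \<Longrightarrow> \<bar>\<phi>s n x - \<phi> x\<bar> \<le> e"
      using uniform_limitD[OF conv e] unfolding eventually_sequentially dist_real_def
      by (meson UNIV_I less_imp_le)
    show ?thesis
    proof (intro exI[of _ N] allI impI ballI)
      fix n \<alpha> assume n: "n \<ge> N" and "\<alpha> \<in> spectrum_R f \<phi>"
      then obtain \<mu> where "\<mu> \<in> invariant_measures f" "integral\<^sup>L \<mu> \<phi> = \<alpha>"
        using spectrum_measure[OF X_compact f_cont phi_cont] by metis
      with only have \<alpha>: "\<alpha> = integral\<^sup>L \<nu> \<phi>" by blast
      have "\<bar>integral\<^sup>L \<nu> (\<phi>s n) - \<alpha>\<bar> \<le> e"
        unfolding \<alpha> using N[OF n] invariant_measuresD[OF \<nu>]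
        by (intro integral_diff_le[OF X_compact phis_cont phi_cont]) auto
      then show "\<exists>\<beta>\<in>spectrum_R f (\<phi>s n). \<bar>\<beta> - \<alpha>\<bar> \<le> e \<and>
        \<bar>real_of_ereal (htop f (level_set f (\<phi>s n) \<beta>)) - real_of_ereal (htop f (level_set f \<phi> \<alpha>))\<bar> \<le> e"
        using e invariant_measure_level_set(1)[OF H3 \<nu> phis_cont[of n]]
        by (intro bexI[of _ "integral\<^sup>L \<nu> (\<phi>s n)"]) (simp_all add: \<alpha> E0 phi_cont phis_cont)
    qed
  qed
  have ne: "entropy_graph f \<phi> \<noteq> {}"
    using invariant_measure_level_set(1)[OF H3 \<nu> phi_cont] by (auto simp: entropy_graph_def)
  show ?thesis
  proof (rule LIMSEQ_I)
    fix e :: real assume "e > 0"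
    \<comment> \<open>Thirds make the distance at most \<open>2 * e / 3\<close>, so the strict bound
      by \<open>e\<close> survives the supremum.\<close>
    then obtain N where N: "\<forall>n\<ge>N. \<forall>\<alpha>\<in>spectrum_R f \<phi>. \<exists>\<beta>\<in>spectrum_R f (\<phi>s n). \<bar>\<beta> - \<alpha>\<bar> \<le> e/3 \<and>
      \<bar>real_of_ereal (htop f (level_set f (\<phi>s n) \<beta>)) - real_of_ereal (htop f (level_set f \<phi> \<alpha>))\<bar> \<le> e/3"
      using close[of "e/3"] by auto
    show "\<exists>no. \<forall>n\<ge>no. norm ((SUP q\<in>entropy_graph f \<phi>. infdist q (entropy_graph f (\<phi>s n))) - 0) < e"
    proof (intro exI[of _ N] allI impI)
      fix n assume n: "n \<ge> N"
      have le: "infdist q (entropy_graph f (\<phi>s n)) \<le> 2 * e / 3" if q: "q \<in> entropy_graph f \<phi>" for q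
      proof -
        obtain \<alpha> where \<alpha>: "\<alpha> \<in> spectrum_R f \<phi>" "q = (\<alpha>, real_of_ereal (htop f (level_set f \<phi> \<alpha>)))"
          using q unfolding entropy_graph_def by blast
        obtain \<beta> where \<beta>: "\<beta> \<in> spectrum_R f (\<phi>s n)" "\<bar>\<beta> - \<alpha>\<bar> \<le> e/3"
          "\<bar>real_of_ereal (htop f (level_set f (\<phi>s n) \<beta>)) - real_of_ereal (htop f (level_set f \<phi> \<alpha>))\<bar> \<le> e/3"
          using N n \<alpha>(1) by blast
        let ?p = "(\<beta>, real_of_ereal (htop f (level_set f (\<phi>s n) \<beta>)))"
        have "infdist q (entropy_graph f (\<phi>s n)) \<le> dist q ?p"
          using \<beta>(1) by (intro infdist_le) (auto simp: entropy_graph_def)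
        also have "\<dots> \<le> \<bar>\<beta> - \<alpha>\<bar> + \<bar>real_of_ereal (htop f (level_set f (\<phi>s n) \<beta>)) - real_of_ereal (htop f (level_set f \<phi> \<alpha>))\<bar>"
          using sqrt_sum_squares_le_sum_abs by (simp add: \<alpha>(2) dist_Pair_Pair dist_real_def abs_minus_commute)
        also have "\<dots> \<le> 2 * e / 3" using \<beta> by linarith
        finally show ?thesis .
      qed
      have "(SUP q\<in>entropy_graph f \<phi>. infdist q (entropy_graph f (\<phi>s n))) \<le> 2 * e / 3"
        by (rule cSUP_least[OF ne le])
      \<comment> \<open>A real supremum dominates its members only if the set is bounded above,
        which \<open>le\<close> supplies.\<close>
      moreover have "0 \<le> (SUP q\<in>entropy_graph f \<phi>. infdist q (entropy_graph f (\<phi>s n)))"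
      proof -
        obtain q where q: "q \<in> entropy_graph f \<phi>" using ne by blast
        have "infdist q (entropy_graph f (\<phi>s n)) \<le> (SUP q\<in>entropy_graph f \<phi>. infdist q (entropy_graph f (\<phi>s n)))"
          by (rule cSUP_upper[OF q bdd_aboveI2[OF le]])
        then show ?thesis using infdist_nonneg order_trans by blast
      qed
      ultimately show "norm ((SUP q\<in>entropy_graph f \<phi>. infdist q (entropy_graph f (\<phi>s n))) - 0) < e"
        using \<open>e > 0\<close> by simp
    qed
  qed
qed

end
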